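(* Let $(R,\mathfrak m)$ be a local Noetherian ring of dimension $d>0$ with infinite residue field. Then for any minimal reduction $J$ of $\mathfrak m$, $$2e_0(\mathfrak m)-e_1(\mathfrak m)+e_1(J)\le \mu(\mathfrak m)-d+2.$$
   Context: For an $\mathfrak m$-primary ideal $I$ of a local Noetherian ring $(R,\mathfrak m)$ of dimension $d>0$, the Hilbert coefficients $e_0(I),\dots,e_d(I)$ are the integers such that, for $n\gg 0$, $\lambda(R/I^n)=e_0(I)\binom{n+d-1}{d}-e_1(I)\binom{n+d-2}{d-1}+\cdots+(-1)^d e_d(I)$, where $\lambda(\cdot)$ denotes length. A minimal reduction $J$ of $I$ is an ideal $J\subseteq I$ generated by $d$ elements such that $I^{r+1}=JI^r$ for some integer $r\ge 0$ (so $J$ is itself $\mathfrak m$-primary and $e_i(J)$ is defined). $\mu(\cdot)$ denotes the minimal number of generators. *)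

theory Defs
  imports "HOL-Algebra.Algebra" "HOL-Library.Extended_Nat"
begin

locale local_ring = cring R + maximalideal \<mm> R for \<mm> and R (structure) +
  assumes maximalideal_unique: "maximalideal M R \<Longrightarrow> M = \<mm>"

text \<open>The supremum is taken over the lengths \<open>n\<close> of chains
  \<open>P 0 \<subset> P 1 \<subset> \<dots> \<subset> P n\<close>, i.e. the number of strict inclusions is counted.\<close>

definition krull_dim :: "('a, 'b) ring_scheme \<Rightarrow> enat" where
  "krull_dim R = Sup {enat n | n. \<exists>P :: nat \<Rightarrow> 'a set.
     (\<forall>i\<le>n. primeideal (P i) R) \<and> (\<forall>i<n. P i \<subset> P (Suc i))}"

definition module_length :: "('a, 'b) ring_scheme \<Rightarrow> ('a, 'c, 'd) module_scheme \<Rightarrow> enat" where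
  "module_length R M = Sup {enat n | n. \<exists>N :: nat \<Rightarrow> 'c set.
     (\<forall>i\<le>n. submodule (N i) R M) \<and> (\<forall>i<n. N i \<subset> N (Suc i))}"

text \<open>The residue class ring \<open>R Quot I\<close>, regarded as a module over \<open>R\<close>.\<close>

definition quotient_module :: "('a, 'b) ring_scheme \<Rightarrow> 'a set \<Rightarrow> ('a, 'a set) module" where
  "quotient_module R I =
    ring.extend (R Quot I)
      (module.fields (\<lambda>a x. (I +>\<^bsub>R\<^esub> a) \<otimes>\<^bsub>R Quot I\<^esub> x))"

lemma (in cring) quotient_module_is_module:
  assumes "ideal I R"
  shows "module R (quotient_module R I)"
proof -
  interpret I: ideal I R by (rule assms)
  interpret Q: cring "R Quot I" by (rule I.quotient_is_cring) (rule cring_axioms)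
  have hom: "(+>) I \<in> ring_hom R (R Quot I)" by (rule I.rcos_ring_hom)
  have "abelian_group (quotient_module R I)"
  proof (rule abelian_groupI)
    fix x assume "x \<in> carrier (quotient_module R I)"
    then have x: "x \<in> carrier (R Quot I)"
      by (simp add: quotient_module_def ring.defs module.defs)
    show "\<exists>y\<in>carrier (quotient_module R I).
        y \<oplus>\<^bsub>quotient_module R I\<^esub> x = \<zero>\<^bsub>quotient_module R I\<^esub>"
      using Q.a_inv_closed[OF x] Q.l_neg[OF x]
      by (auto simp: quotient_module_def ring.defs module.defs)
  qed (auto simp: quotient_module_def ring.defs module.defs Q.a_ac)
  then show ?thesis
    using ring_hom_closed[OF hom] ring_hom_mult[OF hom] ring_hom_add[OF hom] ring_hom_one[OF hom]
    by (intro moduleI)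
      (auto simp: quotient_module_def ring.defs module.defs Q.l_distr Q.r_distr Q.m_assoc intro: cring_axioms)
qed

definition ideal_power :: "('a, 'b) ring_scheme \<Rightarrow> 'a set \<Rightarrow> nat \<Rightarrow> 'a set" where
  "ideal_power R I n = I [^]\<^bsub>ideals_set R\<^esub> n"

definition min_num_generators :: "('a, 'b) ring_scheme \<Rightarrow> 'a set \<Rightarrow> nat" where
  "min_num_generators R I =
    (LEAST n. \<exists>S. S \<subseteq> carrier R \<and> finite S \<and> card S = n \<and> I = Idl\<^bsub>R\<^esub> S)"

text \<open>Only the values \<open>e 0, \<dots>, e d\<close> are constrained, where \<open>d\<close> is the dimension of \<open>R\<close>.
  For \<open>n \<ge> 1\<close> and \<open>i \<le> d\<close> the subtractions below are not truncated.\<close>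

definition hilbert_coeffs :: "('a, 'b) ring_scheme \<Rightarrow> 'a set \<Rightarrow> (nat \<Rightarrow> int) \<Rightarrow> bool" where
  "hilbert_coeffs R I e \<longleftrightarrow>
    (\<forall>\<^sub>F n in sequentially. \<exists>l :: nat. module_length R (quotient_module R (ideal_power R I n)) = enat l \<and>
       int l = (let d = the_enat (krull_dim R)
                in \<Sum>i\<le>d. (-1) ^ i * e i * int ((n + d - 1 - i) choose (d - i))))"

definition hilbert_coeff :: "('a, 'b) ring_scheme \<Rightarrow> 'a set \<Rightarrow> nat \<Rightarrow> int" where
  "hilbert_coeff R I i = (THE c. \<exists>e. hilbert_coeffs R I e \<and> e i = c)"

text \<open>The generators are given as a family, so repetitions among them are allowed.\<close>

definition minimal_reduction :: "('a, 'b) ring_scheme \<Rightarrow> 'a set \<Rightarrow> 'a set \<Rightarrow> bool" where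
  "minimal_reduction R J I \<longleftrightarrow>
    J \<subseteq> I \<and>
    (\<exists>x :: nat \<Rightarrow> 'a. x ` {..<the_enat (krull_dim R)} \<subseteq> carrier R \<and>
       J = Idl\<^bsub>R\<^esub> (x ` {..<the_enat (krull_dim R)})) \<and>
    (\<exists>r. ideal_power R I (r + 1) = J \<cdot>\<^bsub>R\<^esub> ideal_power R I r)"

end

theory Submission
  imports Defs
begin

text \<open>For large \<open>n\<close>, the filtration \<open>J\<^sup>n \<supseteq> J\<^sup>n \<mm> \<supseteq> J\<^sup>n (J + \<mm>\<^sup>2) \<supseteq> J\<^sup>n \<mm>\<^sup>2\<close> bounds the length of
  \<open>R / \<mm>\<^sup>n\<^sup>+\<^sup>2\<close>, since \<open>J\<^sup>n \<mm>\<^sup>2 \<subseteq> \<mm>\<^sup>n\<^sup>+\<^sup>2\<close>. The ideal \<open>J\<^sup>n\<close> is generated by the monomials of degree \<open>n\<close> in the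
  \<open>d\<close> generators of \<open>J\<close>, so the lengths of the three successive quotients are at most
  \<open>N\<^sub>n\<close>, \<open>h N\<^sub>n\<close> and \<open>N\<^sub>n\<^sub>+\<^sub>1\<close>, where \<open>N\<^sub>n\<close> is the number of these monomials and \<open>h\<close> the length of
  \<open>\<mm> / (J + \<mm>\<^sup>2)\<close>. As \<open>e\<^sub>0(J) = e\<^sub>0(\<mm>)\<close>, comparing the coefficients of \<open>n\<^sup>d\<^sup>-\<^sup>1\<close> in
  \<open>\<lambda>(R / \<mm>\<^sup>n\<^sup>+\<^sup>2) \<le> \<lambda>(R / J\<^sup>n) + (1 + h) N\<^sub>n + N\<^sub>n\<^sub>+\<^sub>1\<close> gives \<open>2 e\<^sub>0(\<mm>) - e\<^sub>1(\<mm>) + e\<^sub>1(J) \<le> h + 2\<close>.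
  Finally \<open>h \<le> \<mu>(\<mm>) - d\<close> because the generators of \<open>J\<close> are independent modulo \<open>\<mm>\<^sup>2\<close>; this uses that
  the Hilbert polynomial of \<open>\<mm>\<close> has degree at least \<open>d\<close>, which follows from Artin--Rees along a chain
  of primes. Hilbert polynomials of degree at most \<open>d\<close> exist for both \<open>J\<close> and \<open>\<mm>\<close>, as \<open>\<Oplus> J\<^sup>n\<close> and
  \<open>\<Oplus> \<mm>\<^sup>n\<^sup>+\<^sup>r = \<Oplus> J\<^sup>n \<mm>\<^sup>r\<close> are finitely generated graded modules over a polynomial ring in \<open>d\<close> variables.\<close>

no_notation Sum_Type.Plus (infixr \<open><+>\<close> 65)

section \<open>Numerical polynomials\<close>

text \<open>\<open>leading k f c\<close> says that the \<open>k\<close>-th difference of \<open>f\<close> is eventually \<open>c\<close>, so that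
  \<open>f n\<close> eventually agrees with a polynomial \<open>c n\<^sup>k / k! + \<dots>\<close> of degree at most \<open>k\<close>; in particular
  \<open>leading (Suc k) f 0\<close> bounds the degree by \<open>k\<close>.\<close>

primrec leading :: "nat \<Rightarrow> (nat \<Rightarrow> int) \<Rightarrow> int \<Rightarrow> bool" where
  "leading 0 f c \<longleftrightarrow> (\<forall>\<^sub>F n in sequentially. f n = c)"
| "leading (Suc k) f c \<longleftrightarrow> leading k (\<lambda>n. f (Suc n) - f n) c"

lemma leading_cong:
  assumes "leading k f c" "\<forall>\<^sub>F n in sequentially. f n = g n"
  shows "leading k g c"
  using assms
proof (induction k arbitrary: f g)
  case 0
  then show ?case by (auto elim: eventually_elim2)
next
  case (Suc k)
  have "\<forall>\<^sub>F n in sequentially. f (Suc n) = g (Suc n)"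
    using Suc.prems(2) eventually_sequentially_Suc[of "\<lambda>n. f n = g n"] by simp
  with Suc.prems(2) have "\<forall>\<^sub>F n in sequentially. f (Suc n) - f n = g (Suc n) - g n"
    by (auto elim: eventually_elim2)
  with Suc show ?case by auto
qed

lemma leading_unique: "leading k f c \<Longrightarrow> leading k f c' \<Longrightarrow> c = c'"
proof (induction k arbitrary: f)
  case 0
  then have "\<forall>\<^sub>F n in sequentially. f n = c" "\<forall>\<^sub>F n in sequentially. f n = c'" by simp_all
  then have "\<forall>\<^sub>F n::nat in sequentially. c = c'"
    by (rule eventually_elim2) simp
  then show ?case by simp
qed auto

lemma leading_add: "leading k f c \<Longrightarrow> leading k g c' \<Longrightarrow> leading k (\<lambda>n. f n + g n) (c + c')"
proof (induction k arbitrary: f g)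
  case 0
  then show ?case by (auto elim: eventually_elim2)
next
  case (Suc k)
  then have "leading k (\<lambda>n. (f (Suc n) - f n) + (g (Suc n) - g n)) (c + c')" by auto
  then show ?case by (simp add: algebra_simps)
qed

lemma leading_cmult: "leading k f c \<Longrightarrow> leading k (\<lambda>n. a * f n) (a * c)"
proof (induction k arbitrary: f)
  case 0
  then show ?case by (auto elim: eventually_mono)
next
  case (Suc k)
  then have "leading k (\<lambda>n. a * (f (Suc n) - f n)) (a * c)" by auto
  then show ?case by (simp add: algebra_simps)
qed

lemma leading_diff: "leading k f c \<Longrightarrow> leading k g c' \<Longrightarrow> leading k (\<lambda>n. f n - g n) (c - c')"
  using leading_add[of k f c "\<lambda>n. (-1) * g n" "(-1) * c'"] leading_cmult[of k g c' "-1"] by simp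

lemma leading_shift: "leading k (\<lambda>n. f (n + m)) c \<longleftrightarrow> leading k f c"
proof (induction k arbitrary: f)
  case 0
  then show ?case using eventually_sequentially_seg[of "\<lambda>n. f n = c"] by simp
next
  case (Suc k)
  from Suc[of "\<lambda>n. f (Suc n) - f n"] show ?case by simp
qed

lemma leading_Suc_0: "leading k f c \<Longrightarrow> leading (Suc k) f 0"
proof (induction k arbitrary: f)
  case 0
  then have "\<forall>\<^sub>F n in sequentially. f (Suc n) = c"
    using eventually_sequentially_Suc[of "\<lambda>n. f n = c"] by simp
  with 0 show ?case by (auto elim: eventually_elim2)
qed (metis leading.simps(2))

text \<open>A sequence whose difference eventually vanishes is eventually constant, and the general
  case applies this to higher differences. Thus a degree bound always comes with a leading
  coefficient.\<close>

lemma leading_Suc_0_iff: "leading (Suc k) f 0 \<longleftrightarrow> (\<exists>c. leading k f c)"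
proof (rule iffI)
  show "leading (Suc k) f 0 \<Longrightarrow> \<exists>c. leading k f c"
  proof (induction k arbitrary: f)
    case 0
    then obtain N where "\<And>n. n \<ge> N \<Longrightarrow> f (Suc n) = f n"
      by (auto simp: eventually_sequentially)
    then have "f (N + m) = f N" for m
      by (induction m) auto
    then have "f n = f N" if "n \<ge> N" for n
      using that by (metis le_add_diff_inverse)
    then show ?case by (auto simp: eventually_sequentially)
  next
    case (Suc k)
    then show ?case
      using Suc.IH[of "\<lambda>n. f (Suc n) - f n"] by (simp only: leading.simps)
  qed
qed (auto dest: leading_Suc_0)

text \<open>Differences that are eventually negative integers are at most \<open>-1\<close>, so the
  sequence itself falls below zero.\<close>

lemma leading_neg: "leading k f c \<Longrightarrow> c < 0 \<Longrightarrow> \<forall>\<^sub>F n in sequentially. f n < 0"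
proof (induction k arbitrary: f)
  case 0
  then show ?case by (auto elim: eventually_mono)
next
  case (Suc k)
  then have "\<forall>\<^sub>F n in sequentially. f (Suc n) - f n < 0"
    using Suc.IH[of "\<lambda>n. f (Suc n) - f n"] by (simp only: leading.simps)
  then obtain N where N: "\<And>n. n \<ge> N \<Longrightarrow> f (Suc n) < f n"
    by (auto simp: eventually_sequentially)
  have "f (N + m) \<le> f N - int m" for m
  proof (induction m)
    case (Suc m)
    then show ?case using N[of "N + m"] by simp
  qed auto
  moreover have "n = N + (n - N)" if "n \<ge> N" for n using that by simp
  ultimately have "f n \<le> f N - int (n - N)" if "n \<ge> N" for n
    using that by metis
  \<comment> \<open>From \<open>N\<close> on every step loses at least one, so
    \<open>\<bar>f N\<bar> + 1\<close> further steps suffice.\<close>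
  then have "f n < 0" if "n \<ge> N + nat \<bar>f N\<bar> + 1" for n
    using that by (smt (verit) nat_le_iff of_nat_add of_nat_diff of_nat_le_iff trans_le_add1 add.commute of_nat_1 int_nat_eq)
  then show ?case by (auto simp: eventually_sequentially)
qed

text \<open>Otherwise \<open>g - f\<close> would be eventually negative. Through this lemma bounds
  on lengths become bounds on Hilbert coefficients.\<close>

lemma leading_mono:
  assumes "leading k f c" "leading k g c'" "\<forall>\<^sub>F n in sequentially. f n \<le> g n"
  shows "c \<le> c'"
proof (rule ccontr)
  assume "\<not> c \<le> c'"
  then have "\<forall>\<^sub>F n in sequentially. g n - f n < 0"
    using leading_neg[OF leading_diff[OF assms(2,1)]] by simp
  with assms(3) have "\<forall>\<^sub>F n::nat in sequentially. False"
    by (rule eventually_elim2) auto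
  then show False by simp
qed

lemma leading_sum:
  assumes "\<And>j. j < m \<Longrightarrow> leading k (f j) c"
  shows "leading k (\<lambda>n. \<Sum>j<m. f j n) (int m * c)"
  using assms
proof (induction m)
  case 0
  have "leading k (\<lambda>n. 0) 0" by (induction k) auto
  then show ?case by simp
next
  case (Suc m)
  then have "leading k (\<lambda>n. (\<Sum>j<m. f j n) + f m n) (int m * c + c)"
    by (intro leading_add) auto
  then show ?case by (simp add: algebra_simps)
qed

text \<open>The difference of \<open>f (K * n)\<close> telescopes into \<open>K\<close> values of
  the difference of \<open>f\<close>, at the arguments \<open>K * n + j\<close>; each contributes
  the same leading coefficient.\<close>

lemma leading_dilate: "leading k f c \<Longrightarrow> K > 0 \<Longrightarrow> leading k (\<lambda>n. f (K * n)) (int K ^ k * c)"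
proof (induction k arbitrary: f)
  case 0
  then obtain N where "\<And>n. n \<ge> N \<Longrightarrow> f n = c" by (auto simp: eventually_sequentially)
  moreover have "K * n \<ge> n" for n using \<open>K > 0\<close> by simp
  ultimately have "\<And>n. n \<ge> N \<Longrightarrow> f (K * n) = c" by (meson order_trans)
  then show ?case by (auto simp: eventually_sequentially)
next
  case (Suc k)
  let ?g = "\<lambda>n. f (Suc n) - f n"
  have "leading k (\<lambda>n. ?g (K * n + j)) (int K ^ k * c)" for j
    using Suc.IH[of "\<lambda>n. ?g (n + j)"] Suc.prems leading_shift[of k ?g j c] by simp
  then have "leading k (\<lambda>n. \<Sum>j<K. ?g (K * n + j)) (int K * (int K ^ k * c))"
    by (rule leading_sum)
  moreover have "(\<Sum>j<K. ?g (K * n + j)) = f (K * Suc n) - f (K * n)" for n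
    using sum_lessThan_telescope[of "\<lambda>j. f (K * n + j)" K] by (simp add: algebra_simps)
  ultimately show ?case by (simp add: mult.assoc)
qed

lemma leading_binomial: "leading k (\<lambda>n. int (n choose k)) 1"
  by (induction k) auto

lemma leading_binomial_shift: "leading k (\<lambda>n. int ((n + m) choose k)) 1"
  using leading_shift[of k "\<lambda>n. int (n choose k)" m 1] leading_binomial by simp

section \<open>Hilbert polynomials in the binomial basis\<close>

definition hilbert_form :: "nat \<Rightarrow> (nat \<Rightarrow> int) \<Rightarrow> nat \<Rightarrow> int" where
  "hilbert_form d e n = (\<Sum>i\<le>d. (-1) ^ i * e i * int ((n + d - 1 - i) choose (d - i)))"

text \<open>Pascal's rule in each term; the last term is constant and cancels.\<close>

lemma hilbert_form_diff:
  "hilbert_form (Suc d) e (Suc n) - hilbert_form (Suc d) e n = hilbert_form d e (Suc n)"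
proof -
  have "int ((n + Suc d - i) choose (Suc d - i)) - int ((n + d - i) choose (Suc d - i))
      = int ((n + d - i) choose (d - i))" if "i \<le> d" for i
  proof -
    have "n + Suc d - i = Suc (n + d - i)" "Suc d - i = Suc (d - i)" using that by auto
    then show ?thesis by simp
  qed
  then have "(-1) ^ i * e i * int ((n + Suc d - i) choose (Suc d - i))
      - (-1) ^ i * e i * int ((n + d - i) choose (Suc d - i))
      = (-1) ^ i * e i * int ((n + d - i) choose (d - i))" if "i \<le> d" for i
    using that by (simp flip: right_diff_distrib)
  then show ?thesis
    by (simp add: hilbert_form_def flip: sum_subtractf)
qed

lemma leading_hilbert_form: "leading d (hilbert_form d e) (e 0)"
proof (induction d)
  case 0
  then show ?case by (simp add: hilbert_form_def)
next
  case (Suc d)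
  then show ?case using leading_shift[of d "hilbert_form d e" 1 "e 0"] by (simp add: hilbert_form_diff)
qed

text \<open>Splitting off the leading term flips the signs of the rest, which is a form of the same
  kind one degree lower, with leading coefficient \<open>e 1\<close>.\<close>

lemma hilbert_form_Suc:
  "hilbert_form (Suc d) e n = e 0 * int ((n + d) choose Suc d) - hilbert_form d (\<lambda>i. e (Suc i)) n"
  by (simp add: hilbert_form_def sum.atMost_Suc_shift sum_negf del: sum.atMost_Suc)

text \<open>Removing the leading binomial term lowers the degree, and induction supplies the
  remaining coefficients.\<close>

lemma hilbert_form_exists:
  assumes "leading (Suc d) f 0"
  shows "\<exists>e. \<forall>\<^sub>F n in sequentially. f n = hilbert_form d e n"
  using assms
proof (induction d arbitrary: f)
  case 0
  then obtain c where "leading 0 f c" by (auto simp only: leading_Suc_0_iff)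
  then show ?case by (intro exI[of _ "\<lambda>_. c"]) (simp add: hilbert_form_def)
next
  case (Suc d)
  define c where "c = (SOME c. leading (Suc d) f c)"
  have c: "leading (Suc d) f c"
    using Suc.prems unfolding leading_Suc_0_iff c_def by (rule someI_ex)
  \<comment> \<open>The remainder is formed as leading term minus \<open>f\<close> to match the sign
    in \<open>hilbert_form_Suc\<close>.\<close>
  have "leading (Suc d) (\<lambda>n. c * int ((n + d) choose Suc d)) c"
    using leading_cmult[OF leading_binomial_shift, of "Suc d" c d] by simp
  from leading_diff[OF this c] have "leading (Suc d) (\<lambda>n. c * int ((n + d) choose Suc d) - f n) 0" by simp
  from Suc.IH[OF this] obtain e where
    "\<forall>\<^sub>F n in sequentially. c * int ((n + d) choose Suc d) - f n = hilbert_form d e n" by blast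
  then have "\<forall>\<^sub>F n in sequentially. f n = hilbert_form (Suc d) (case_nat c e) n"
    by (rule eventually_mono) (simp add: hilbert_form_Suc)
  then show ?case by (rule exI[of _ "case_nat c e"])
qed

lemma hilbert_form_unique:
  assumes "\<forall>\<^sub>F n in sequentially. hilbert_form d e n = hilbert_form d e' n" "i \<le> d"
  shows "e i = e' i"
  using assms
proof (induction d arbitrary: e e' i)
  case 0
  then show ?case by (simp add: hilbert_form_def)
next
  case (Suc d)
  have 0: "e 0 = e' 0"
    using leading_unique[OF leading_cong[OF leading_hilbert_form Suc.prems(1)] leading_hilbert_form] .
  with Suc.prems(1) have "\<forall>\<^sub>F n in sequentially. hilbert_form d (\<lambda>i. e (Suc i)) n = hilbert_form d (\<lambda>i. e' (Suc i)) n"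
    by (simp add: hilbert_form_Suc)
  from Suc.IH[OF this] Suc.prems(2) 0 show ?case by (cases i) auto
qed

text \<open>As the leading coefficients agree,
  \<open>hilbert_form (Suc D) e (n + 2) - hilbert_form (Suc D) e' n\<close> has degree at most
  \<open>D\<close>. Its coefficient there is \<open>2 * e 0 - e 1 + e' 1\<close>, the summand
  \<open>2 * e 0\<close> being due to the shift by two.\<close>

lemma hilbert_coefficient_comparison:
  assumes f: "\<forall>\<^sub>F n in sequentially. f n = hilbert_form (Suc D) e n"
    and g: "\<forall>\<^sub>F n in sequentially. g n = hilbert_form (Suc D) e' n"
    and e0: "e' 0 = e 0"
    and le: "\<And>n. f (n + 2) \<le> g n + (1 + a) * int ((n + D) choose D) + int ((n + 1 + D) choose D)"
  shows "2 * e 0 - e 1 + e' 1 \<le> 2 + a"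
proof -
  let ?h = "hilbert_form D (\<lambda>i. e (Suc i))" and ?h' = "hilbert_form D (\<lambda>i. e' (Suc i))"
  let ?b = "\<lambda>m n. int ((n + m) choose D)"
  have 1: "leading D (\<lambda>n. e 0 * (?b (Suc D) n + ?b D n) - ?h (n + 2) + ?h' n) (e 0 * (1 + 1) - e 1 + e' 1)"
    using leading_hilbert_form[of D "\<lambda>i. e (Suc i)"] leading_hilbert_form[of D "\<lambda>i. e' (Suc i)"]
      leading_shift[of D ?h 2 "e 1"]
    by (intro leading_add leading_diff leading_cmult leading_binomial_shift) simp_all
  have 2: "leading D (\<lambda>n. (1 + a) * ?b D n + ?b (1 + D) n) ((1 + a) * 1 + 1)"
    by (intro leading_add leading_cmult leading_binomial_shift)
  have "\<forall>\<^sub>F n in sequentially. f (n + 2) = hilbert_form (Suc D) e (n + 2)"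
    using f eventually_sequentially_seg[of "\<lambda>n. f n = hilbert_form (Suc D) e n" 2] by simp
  with g have 3: "\<forall>\<^sub>F n in sequentially. e 0 * (?b (Suc D) n + ?b D n) - ?h (n + 2) + ?h' n
      \<le> (1 + a) * ?b D n + ?b (1 + D) n"
  proof (rule eventually_elim2)
    fix n assume "g n = hilbert_form (Suc D) e' n" "f (n + 2) = hilbert_form (Suc D) e (n + 2)"
    \<comment> \<open>Pascal's rule twice: the two extra summands have degree \<open>D\<close> and
      produce \<open>2 * e 0\<close>.\<close>
    moreover have "(n + 2 + D) choose Suc D = ((n + Suc D) choose D) + ((n + D) choose D) + ((n + D) choose Suc D)"
      by (simp add: numeral_2_eq_2)
    ultimately show "e 0 * (?b (Suc D) n + ?b D n) - ?h (n + 2) + ?h' n \<le> (1 + a) * ?b D n + ?b (1 + D) n"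
      using le[of n] e0 by (simp add: hilbert_form_Suc algebra_simps)
  qed
  from leading_mono[OF 1 2 3] show ?thesis by simp
qed

section \<open>Lengths of quotients of ideals\<close>

text \<open>With \<open>ideal_length\<close> this measures the module \<open>B / C\<close>: its
  submodules correspond to the ideals between \<open>C\<close> and \<open>B\<close>, so no quotient
  has to be formed.\<close>

definition ideal_chain :: "('a, 'b) ring_scheme \<Rightarrow> 'a set \<Rightarrow> 'a set \<Rightarrow> nat \<Rightarrow> (nat \<Rightarrow> 'a set) \<Rightarrow> bool" where
  "ideal_chain R C B n N \<longleftrightarrow>
    (\<forall>i\<le>n. ideal (N i) R \<and> C \<subseteq> N i \<and> N i \<subseteq> B) \<and> (\<forall>i<n. N i \<subset> N (Suc i))"

definition ideal_length :: "('a, 'b) ring_scheme \<Rightarrow> 'a set \<Rightarrow> 'a set \<Rightarrow> enat" where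
  "ideal_length R C B = Sup {enat n | n. \<exists>N. ideal_chain R C B n N}"

lemma ideal_length_ge: "ideal_chain R C B n N \<Longrightarrow> enat n \<le> ideal_length R C B"
  unfolding ideal_length_def by (rule Sup_upper) auto

lemma ideal_length_leI:
  "(\<And>n N. ideal_chain R C B n N \<Longrightarrow> enat n \<le> l) \<Longrightarrow> ideal_length R C B \<le> l"
  unfolding ideal_length_def by (rule Sup_least) auto

lemma ideal_chainD:
  assumes "ideal_chain R C B n N" "i \<le> n"
  shows "ideal (N i) R" "C \<subseteq> N i" "N i \<subseteq> B"
  using assms by (auto simp: ideal_chain_def)

text \<open>Longer chains can be truncated, so every finite number below the supremum is the length
  of a chain.\<close>

lemma ideal_length_obtain:
  assumes "enat n \<le> ideal_length R C B" "ideal C R" "C \<subseteq> B"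
  obtains N where "ideal_chain R C B n N"
proof (cases "\<exists>m\<ge>n. \<exists>N. ideal_chain R C B m N")
  case True
  then obtain m N where "m \<ge> n" "ideal_chain R C B m N" by blast
  then have "ideal_chain R C B n N" by (auto simp: ideal_chain_def)
  then show ?thesis by (rule that)
next
  case False
  show ?thesis
  proof (cases n)
    case 0
    \<comment> \<open>A chain of length zero still needs one ideal between \<open>C\<close> and
      \<open>B\<close>; here it is \<open>C\<close> itself.\<close>
    with assms that[of "\<lambda>_. C"] show ?thesis by (simp add: ideal_chain_def)
  next
    case (Suc k)
    with False have "ideal_length R C B \<le> enat k"
      by (intro ideal_length_leI) (metis enat_ord_simps(1) not_less_eq_eq)
    with assms(1) Suc show ?thesis
      by (meson Suc_n_not_le_n enat_ord_simps(1) order_trans)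
  qed
qed

lemma ideal_length_le_map:
  assumes "\<And>L. ideal L R \<Longrightarrow> C \<subseteq> L \<Longrightarrow> L \<subseteq> B \<Longrightarrow> ideal (f L) S \<and> C' \<subseteq> f L \<and> f L \<subseteq> B'"
    and "\<And>L L'. ideal L R \<Longrightarrow> ideal L' R \<Longrightarrow> C \<subseteq> L \<Longrightarrow> L \<subset> L' \<Longrightarrow> L' \<subseteq> B \<Longrightarrow> f L \<subset> f L'"
  shows "ideal_length R C B \<le> ideal_length S C' B'"
proof (rule ideal_length_leI)
  fix n N assume "ideal_chain R C B n N"
  then have "ideal_chain S C' B' n (\<lambda>i. f (N i))"
    using assms by (auto simp: ideal_chain_def)
  then show "enat n \<le> ideal_length S C' B'" by (rule ideal_length_ge)
qed

lemma ideal_length_mono: "C \<subseteq> C' \<Longrightarrow> B' \<subseteq> B \<Longrightarrow> ideal_length R C' B' \<le> ideal_length R C B"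
  by (rule ideal_length_le_map[where f = "\<lambda>L. L"]) auto

lemma ideal_length_self: "ideal_length R C C = 0"
proof -
  have "ideal_length R C C \<le> enat 0"
  proof (rule ideal_length_leI)
    fix n N assume "ideal_chain R C C n N"
    then have "0 < n \<Longrightarrow> N 0 \<subset> N (Suc 0)" "0 < n \<Longrightarrow> N (Suc 0) \<subseteq> C" "C \<subseteq> N 0"
      by (auto simp: ideal_chain_def)
    then have "\<not> 0 < n" by blast
    then show "enat n \<le> enat 0" by simp
  qed
  then show ?thesis by (simp add: zero_enat_def[symmetric])
qed

text \<open>Every chain inside \<open>B\<close> can be prolonged by the larger ideal
  \<open>B'\<close>.\<close>

lemma ideal_length_strict:
  assumes "ideal B R" "ideal B' R" "ideal C R" "C \<subseteq> B" "B \<subset> B'"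
  shows "eSuc (ideal_length R C B) \<le> ideal_length R C B'"
proof -
  have "enat (Suc n) \<le> ideal_length R C B'" if n: "enat n \<le> ideal_length R C B" for n
  proof -
    from n assms(3,4) obtain N where N: "ideal_chain R C B n N" by (rule ideal_length_obtain)
    then have "ideal_chain R C B' (Suc n) (N(Suc n := B'))"
      using assms ideal_chainD[OF N] by (auto simp: ideal_chain_def le_Suc_eq less_Suc_eq; blast)
    then show ?thesis by (rule ideal_length_ge)
  qed
  note * = this
  show ?thesis
  proof (cases "ideal_length R C B'")
    case (enat m)
    have "ideal_length R C B \<le> ideal_length R C B'" using assms by (intro ideal_length_mono) auto
    with enat obtain n where "ideal_length R C B = enat n" by (metis enat_ile)
    with *[of n] show ?thesis by (simp add: eSuc_enat)
  qed simp
qed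

section \<open>Ideal arithmetic and additivity of length\<close>

context ring
begin

lemma mem_set_add: "z \<in> I <+> J \<longleftrightarrow> (\<exists>i\<in>I. \<exists>j\<in>J. z = i \<oplus> j)"
  by (auto simp: set_add_def')

lemma ideal_zero: "ideal I R \<Longrightarrow> \<zero> \<in> I"
  by (simp add: additive_subgroup.zero_closed ideal.axioms(1))

lemma ideal_add: "ideal I R \<Longrightarrow> a \<in> I \<Longrightarrow> b \<in> I \<Longrightarrow> a \<oplus> b \<in> I"
  by (simp add: additive_subgroup.a_closed ideal.axioms(1))

lemma ideal_neg: "ideal I R \<Longrightarrow> a \<in> I \<Longrightarrow> \<ominus> a \<in> I"
  by (simp add: additive_subgroup.a_inv_closed ideal.axioms(1))

lemma ideal_minus: "ideal I R \<Longrightarrow> a \<in> I \<Longrightarrow> b \<in> I \<Longrightarrow> a \<ominus> b \<in> I"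
  by (simp add: a_minus_def ideal_add ideal_neg)

lemma ideal_carrier: "ideal I R \<Longrightarrow> I \<subseteq> carrier R"
  by (auto intro: ideal.Icarr)

lemma ideal_add_cancel:
  assumes "ideal I R" "a \<oplus> b \<in> I" "a \<in> I" "b \<in> carrier R"
  shows "b \<in> I"
proof -
  have "a \<in> carrier R" using assms ideal.Icarr by metis
  then have "b = (a \<oplus> b) \<ominus> a" using assms(4) by algebra
  then show ?thesis using assms ideal_minus by metis
qed

lemma idealI':
  assumes "I \<subseteq> carrier R" "\<zero> \<in> I" "\<And>a b. a \<in> I \<Longrightarrow> b \<in> I \<Longrightarrow> a \<oplus> b \<in> I"
    and "\<And>a x. a \<in> I \<Longrightarrow> x \<in> carrier R \<Longrightarrow> x \<otimes> a \<in> I" "\<And>a x. a \<in> I \<Longrightarrow> x \<in> carrier R \<Longrightarrow> a \<otimes> x \<in> I"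
  shows "ideal I R"
proof (rule idealI)
  show "subgroup I (add_monoid R)"
  proof (rule add.subgroupI)
    fix a assume a: "a \<in> I"
    then have "\<ominus> \<one> \<otimes> a \<in> I" using assms(4) by blast
    moreover have "\<ominus> \<one> \<otimes> a = \<ominus> a" using a assms(1) l_minus by auto
    ultimately show "\<ominus> a \<in> I" by simp
  qed (use assms in auto)
qed (use assms ring_axioms in auto)

lemma set_add_upper1: "ideal I R \<Longrightarrow> ideal J R \<Longrightarrow> I \<subseteq> I <+> J"
  by (metis le_sup_iff genideal_self ideal_carrier union_genideal)

lemma set_add_upper2: "ideal I R \<Longrightarrow> ideal J R \<Longrightarrow> J \<subseteq> I <+> J"
  by (metis le_sup_iff genideal_self ideal_carrier union_genideal)

lemma set_add_least: "ideal K R \<Longrightarrow> I \<subseteq> K \<Longrightarrow> J \<subseteq> K \<Longrightarrow> I <+> J \<subseteq> K"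
  by (auto simp: mem_set_add intro!: ideal_add)

lemma set_add_mono: "I \<subseteq> I' \<Longrightarrow> J \<subseteq> J' \<Longrightarrow> I <+> J \<subseteq> I' <+> J'"
  unfolding subset_iff mem_set_add by blast

lemma set_add_absorb: "ideal I R \<Longrightarrow> ideal J R \<Longrightarrow> J \<subseteq> I \<Longrightarrow> I <+> J = I"
  by (meson order_refl set_add_least set_add_upper1 subset_antisym)

lemma ideal_prod_least:
  assumes "ideal K R" "\<And>i j. i \<in> I \<Longrightarrow> j \<in> J \<Longrightarrow> i \<otimes> j \<in> K"
  shows "I \<cdot> J \<subseteq> K"
proof
  fix x assume "x \<in> I \<cdot> J"
  then show "x \<in> K" by induction (auto intro: assms ideal_add)
qed

lemma ideal_prod_mono:
  assumes "I \<subseteq> I'" "J \<subseteq> J'"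
  shows "I \<cdot> J \<subseteq> I' \<cdot> J'"
proof
  fix x assume "x \<in> I \<cdot> J"
  then show "x \<in> I' \<cdot> J'" by induction (use assms in \<open>auto intro: ideal_prod.intros\<close>)
qed

text \<open>If \<open>n \<oplus> b\<close> lies in \<open>L'\<close> with \<open>n \<in> L\<close>
  and \<open>b \<in> B\<close>, then \<open>b\<close> lies in \<open>L' \<inter> B\<close> and hence
  in \<open>L\<close>.\<close>

lemma ideal_modular:
  assumes "ideal L R" "ideal L' R" "ideal B R" "L \<subseteq> L'" "L' \<inter> B \<subseteq> L" "L' \<subseteq> L <+> B"
  shows "L = L'"
proof
  show "L' \<subseteq> L"
  proof
    fix y assume y: "y \<in> L'"
    with assms(6) obtain n b where nb: "n \<in> L" "b \<in> B" "y = n \<oplus> b"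
      unfolding subset_iff mem_set_add by blast
    have "b \<in> carrier R" using nb(2) by (rule ideal.Icarr[OF assms(3)])
    then have "b \<in> L'" using ideal_add_cancel[OF assms(2), of n b] y nb assms(4) by blast
    then have "b \<in> L" using nb(2) assms(5) by blast
    then show "y \<in> L" using nb assms(1) ideal_add by simp
  qed
qed (fact assms(4))

text \<open>Chains below and above \<open>B\<close> concatenate, which gives one inequality. For the
  other, every strict step of a chain enlarges its intersection with \<open>B\<close> or its sum
  with \<open>B\<close>.\<close>

lemma ideal_length_add:
  assumes "ideal A R" "ideal B R" "ideal C R" "C \<subseteq> B" "B \<subseteq> A"
  shows "ideal_length R C A = ideal_length R C B + ideal_length R B A"
proof (rule antisym)
  show "ideal_length R C A \<le> ideal_length R C B + ideal_length R B A"
  proof (rule ideal_length_leI)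
    fix n N assume N: "ideal_chain R C A n N"
    have "enat i \<le> ideal_length R C (N i \<inter> B) + ideal_length R B (N i <+> B)" if "i \<le> n" for i
      using that
    proof (induction i)
      case 0
      then show ?case by (simp flip: zero_enat_def)
    next
      case (Suc i)
      define L L' where "L = N i" "L' = N (Suc i)"
      have L: "ideal L R" "ideal L' R" "C \<subseteq> L" "L \<subset> L'"
        using N Suc.prems by (auto simp: ideal_chain_def L_L'_def)
      have "eSuc (ideal_length R C (L \<inter> B) + ideal_length R B (L <+> B))
          \<le> ideal_length R C (L' \<inter> B) + ideal_length R B (L' <+> B)"
      proof (cases "L' \<inter> B \<subseteq> L")
        case False
        then have "eSuc (ideal_length R C (L \<inter> B)) \<le> ideal_length R C (L' \<inter> B)"
          using L assms by (intro ideal_length_strict i_intersect) auto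
        moreover have "ideal_length R B (L <+> B) \<le> ideal_length R B (L' <+> B)"
          using L by (intro ideal_length_mono set_add_mono) auto
        ultimately show ?thesis by (metis add_mono iadd_Suc)
      next
        case True
        \<comment> \<open>Nothing new enters inside \<open>B\<close>, so the modular law forces the
          sum with \<open>B\<close> to grow.\<close>
        then have "L <+> B \<noteq> L' <+> B"
          using ideal_modular[of L L' B] set_add_upper1[of L' B] L assms by auto
        moreover have "L <+> B \<subseteq> L' <+> B" using L by (intro set_add_mono) auto
        ultimately have "eSuc (ideal_length R B (L <+> B)) \<le> ideal_length R B (L' <+> B)"
          using L assms by (intro ideal_length_strict add_ideals set_add_upper2) auto
        moreover have "ideal_length R C (L \<inter> B) \<le> ideal_length R C (L' \<inter> B)"
          using L by (intro ideal_length_mono) auto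
        ultimately show ?thesis by (metis add_mono iadd_Suc_right)
      qed
      moreover have "enat (Suc i) \<le> eSuc (ideal_length R C (L \<inter> B) + ideal_length R B (L <+> B))"
        using Suc L_L'_def by (simp flip: eSuc_enat)
      ultimately show ?case unfolding L_L'_def by (rule order_trans[rotated])
    qed
    from this[of n] have "enat n \<le> ideal_length R C (N n \<inter> B) + ideal_length R B (N n <+> B)" by simp
    also have "\<dots> \<le> ideal_length R C B + ideal_length R B A"
      using assms ideal_chainD[OF N, of n] by (intro add_mono ideal_length_mono set_add_least) auto
    finally show "enat n \<le> ideal_length R C B + ideal_length R B A" .
  qed
next
  have *: "enat (n + m) \<le> ideal_length R C A"
    if n: "enat n \<le> ideal_length R C B" and m: "enat m \<le> ideal_length R B A" for n m
  proof -
    from n assms obtain N where N: "ideal_chain R C B n N" by (auto elim: ideal_length_obtain)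
    from m assms obtain M where M: "ideal_chain R B A m M" by (auto elim: ideal_length_obtain)
    \<comment> \<open>Index \<open>n\<close> takes \<open>M 0\<close> in place of
      \<open>N n\<close>. The two may differ, but \<open>N n \<subseteq> B \<subseteq> M 0\<close>
      keeps the step before it strict.\<close>
    define K where "K i = (if i < n then N i else M (i - n))" for i
    have "K i \<subset> K (Suc i)" if "i < n + m" for i
    proof (cases "Suc i < n")
      case True
      then show ?thesis using N by (auto simp: K_def ideal_chain_def)
    next
      case False
      show ?thesis
      proof (cases "Suc i = n")
        case True
        then have "N i \<subset> N n" "N n \<subseteq> B" "B \<subseteq> M 0"
          using N M by (auto simp: ideal_chain_def)
        then show ?thesis using True by (auto simp: K_def)
      next
        case F: False
        with False have "i \<ge> n" by simp
        then show ?thesis using M that by (auto simp: K_def ideal_chain_def Suc_diff_le)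
      qed
    qed
    moreover have "ideal (K i) R \<and> C \<subseteq> K i \<and> K i \<subseteq> A" if "i \<le> n + m" for i
    proof (cases "i < n")
      case True
      then have "ideal (N i) R" "C \<subseteq> N i" "N i \<subseteq> B" using ideal_chainD[OF N, of i] by auto
      then show ?thesis using True assms(5) by (auto simp: K_def)
    next
      case False
      then have "ideal (M (i - n)) R" "B \<subseteq> M (i - n)" "M (i - n) \<subseteq> A"
        using ideal_chainD[OF M, of "i - n"] that by auto
      then show ?thesis using False assms(4) by (auto simp: K_def)
    qed
    ultimately have "ideal_chain R C A (n + m) K" by (auto simp: ideal_chain_def)
    then show ?thesis by (rule ideal_length_ge)
  qed
  show "ideal_length R C B + ideal_length R B A \<le> ideal_length R C A"
  proof (cases "ideal_length R C A")
    case (enat l)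
    moreover have "ideal_length R C B \<le> ideal_length R C A" "ideal_length R B A \<le> ideal_length R C A"
      using assms by (auto intro: ideal_length_mono)
    ultimately obtain n m where "ideal_length R C B = enat n" "ideal_length R B A = enat m"
      by (metis enat_ile)
    then show ?thesis using *[of n m] by simp
  qed simp
qed

end

section \<open>Multiplication by an element, colon ideals and products\<close>

context cring
begin

lemma ideal_l_coset:
  assumes "ideal B R" "x \<in> carrier R"
  shows "ideal (x <# B) R"
proof (rule idealI')
  have B: "B \<subseteq> carrier R" using assms ideal_carrier by blast
  show "x <# B \<subseteq> carrier R" using B assms(2) by (auto simp: l_coset_def)
  show "\<zero> \<in> x <# B"
    using ideal_zero[OF assms(1)] assms(2) by (force simp: l_coset_def)
  show "a \<oplus> b \<in> x <# B" if "a \<in> x <# B" "b \<in> x <# B" for a b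
  proof -
    from that obtain a' b' where ab: "a' \<in> B" "b' \<in> B" "a = x \<otimes> a'" "b = x \<otimes> b'" by (auto simp: l_coset_def)
    then have "a' \<in> carrier R" "b' \<in> carrier R" using B by auto
    then have "a \<oplus> b = x \<otimes> (a' \<oplus> b')" unfolding ab using assms(2) by (simp add: r_distr)
    with ab ideal_add[OF assms(1)] show ?thesis by (auto simp: l_coset_def)
  qed
  show *: "y \<otimes> a \<in> x <# B" if "a \<in> x <# B" "y \<in> carrier R" for a y
  proof -
    from that obtain a' where a: "a' \<in> B" "a = x \<otimes> a'" by (auto simp: l_coset_def)
    then have "y \<otimes> a = x \<otimes> (y \<otimes> a')" using B assms(2) that(2) by (auto simp: m_lcomm)
    with a that ideal.I_l_closed[OF assms(1)] show ?thesis by (auto simp: l_coset_def)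
  qed
  show "a \<otimes> y \<in> x <# B" if "a \<in> x <# B" "y \<in> carrier R" for a y
  proof -
    have "a \<in> carrier R" using that(1) B assms(2) by (auto simp: l_coset_def)
    then have "a \<otimes> y = y \<otimes> a" using that(2) by (rule m_comm)
    then show ?thesis using *[OF that] by simp
  qed
qed

lemma ideal_colon:
  assumes "ideal B R" "ideal C R" "x \<in> carrier R"
  shows "ideal {b \<in> B. x \<otimes> b \<in> C} R"
proof -
  have B: "b \<in> carrier R" if "b \<in> B" for b using that assms ideal_carrier by blast
  show ?thesis
  proof (rule idealI')
    show "a \<otimes> y \<in> {b \<in> B. x \<otimes> b \<in> C}" if "a \<in> {b \<in> B. x \<otimes> b \<in> C}" "y \<in> carrier R" for a y
      using that assms B ideal.I_r_closed[OF assms(1)] ideal.I_r_closed[OF assms(2), of "x \<otimes> a" y]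
      by (auto simp: m_assoc)
    then show "y \<otimes> a \<in> {b \<in> B. x \<otimes> b \<in> C}" if "a \<in> {b \<in> B. x \<otimes> b \<in> C}" "y \<in> carrier R" for a y
      using that B m_comm[of y a] by auto
  qed (use assms B ideal_zero ideal_add in \<open>auto simp: r_distr\<close>)
qed

text \<open>The isomorphism \<open>B / {b \<in> B. x b \<in> Y} \<cong> (x B + Y) / Y\<close>.\<close>

lemma ideal_length_colon:
  assumes "ideal B R" "ideal Y R" and x: "x \<in> carrier R"
  shows "ideal_length R Y ((x <# B) <+> Y) = ideal_length R {b \<in> B. x \<otimes> b \<in> Y} B"
proof (rule antisym)
  note xB = ideal_l_coset[OF assms(1) x]
  show "ideal_length R Y ((x <# B) <+> Y) \<le> ideal_length R {b \<in> B. x \<otimes> b \<in> Y} B"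
  proof (rule ideal_length_le_map[where f = "\<lambda>L. {b \<in> B. x \<otimes> b \<in> L}"])
    fix L L' assume L: "ideal L R" "ideal L' R" "Y \<subseteq> L" "L \<subset> L'" "L' \<subseteq> (x <# B) <+> Y"
    then obtain z where z: "z \<in> L'" "z \<notin> L" by blast
    with L have "z \<in> (x <# B) <+> Y" by blast
    then obtain b y where by': "b \<in> B" "y \<in> Y" "z = x \<otimes> b \<oplus> y"
      by (auto simp: mem_set_add l_coset_def)
    have c: "b \<in> carrier R" "y \<in> carrier R" using by' assms ideal_carrier by blast+
    then have "z = y \<oplus> x \<otimes> b" using by' x a_comm by simp
    with z(1) by' L c x have "x \<otimes> b \<in> L'" using ideal_add_cancel[OF L(2), of y "x \<otimes> b"] by auto
    moreover have "x \<otimes> b \<notin> L" using z(2) by' L ideal_add[OF L(1)] by blast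
    ultimately show "{b \<in> B. x \<otimes> b \<in> L} \<subset> {b \<in> B. x \<otimes> b \<in> L'}" using L by'(1) by blast
  qed (use assms ideal_colon in blast)
  show "ideal_length R {b \<in> B. x \<otimes> b \<in> Y} B \<le> ideal_length R Y ((x <# B) <+> Y)"
  proof (rule ideal_length_le_map[where f = "\<lambda>L. (x <# L) <+> Y"])
    fix L assume L: "ideal L R" "{b \<in> B. x \<otimes> b \<in> Y} \<subseteq> L" "L \<subseteq> B"
    have "x <# L \<subseteq> x <# B" using L by (auto simp: l_coset_def)
    then show "ideal ((x <# L) <+> Y) R \<and> Y \<subseteq> (x <# L) <+> Y \<and> (x <# L) <+> Y \<subseteq> (x <# B) <+> Y"
      using L assms by (intro conjI add_ideals set_add_upper2 set_add_mono ideal_l_coset) auto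
  next
    fix L L' assume L: "ideal L R" "ideal L' R" "{b \<in> B. x \<otimes> b \<in> Y} \<subseteq> L" "L \<subset> L'" "L' \<subseteq> B"
    then obtain z where z: "z \<in> L'" "z \<notin> L" by blast
    have "x \<otimes> z \<notin> (x <# L) <+> Y"
    proof
      assume "x \<otimes> z \<in> (x <# L) <+> Y"
      then obtain b y where by': "b \<in> L" "y \<in> Y" "x \<otimes> z = x \<otimes> b \<oplus> y"
        by (auto simp: mem_set_add l_coset_def)
      have c: "b \<in> carrier R" "y \<in> carrier R" "z \<in> carrier R" using by' z L assms ideal_carrier by blast+
      have "x \<otimes> (z \<ominus> b) = x \<otimes> z \<ominus> x \<otimes> b" using c x by algebra
      also have "\<dots> = y" unfolding by'(3) using c x by algebra
      finally have "z \<ominus> b \<in> L" using L z by' assms(1) ideal_minus[of B z b] by auto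
      then have "(z \<ominus> b) \<oplus> b \<in> L" using by' L ideal_add by blast
      moreover have "(z \<ominus> b) \<oplus> b = z" using c by algebra
      ultimately show False using z by simp
    qed
    moreover have "x \<otimes> z \<in> (x <# L') <+> Y"
      using z L assms set_add_upper1[OF ideal_l_coset[OF L(2) x] assms(2)] by (auto simp: l_coset_def)
    moreover have "(x <# L) <+> Y \<subseteq> (x <# L') <+> Y"
      using L by (intro set_add_mono) (auto simp: l_coset_def)
    ultimately show "(x <# L) <+> Y \<subset> (x <# L') <+> Y" by blast
  qed
qed

text \<open>Multiplication by \<open>x\<close> induces a surjection of \<open>B / C\<close> onto
  \<open>(x B + Y) / Y\<close>, because \<open>x C\<close> lies in \<open>Y\<close>.\<close>

lemma ideal_length_l_coset_le:
  assumes "ideal B R" "ideal C R" "ideal Y R" "C \<subseteq> B" "x \<in> carrier R" "\<And>c. c \<in> C \<Longrightarrow> x \<otimes> c \<in> Y"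
  shows "ideal_length R Y ((x <# B) <+> Y) \<le> ideal_length R C B"
  using assms by (subst ideal_length_colon) (auto intro: ideal_length_mono)

lemma genideal_insert:
  assumes "a \<in> carrier R" "S \<subseteq> carrier R"
  shows "Idl (insert a S) = (a <# carrier R) <+> Idl S"
proof
  have i: "ideal (a <# carrier R) R" "ideal (Idl S) R" "ideal (Idl (insert a S)) R"
    using assms by (auto intro: ideal_l_coset oneideal genideal_ideal)
  have "a \<in> a <# carrier R" using assms by (auto simp: l_coset_def intro!: bexI[of _ \<one>])
  then show "Idl (insert a S) \<subseteq> (a <# carrier R) <+> Idl S"
    using i genideal_self[OF assms(2)] set_add_upper1[OF i(1,2)] set_add_upper2[OF i(1,2)]
    by (intro genideal_minimal add_ideals) auto
  have "a \<in> Idl (insert a S)" using genideal_self[of "insert a S"] assms by auto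
  then have "a <# carrier R \<subseteq> Idl (insert a S)"
    using ideal.I_r_closed[OF i(3)] by (auto simp: l_coset_def)
  then show "(a <# carrier R) <+> Idl S \<subseteq> Idl (insert a S)"
    using i assms by (intro set_add_least subset_Idl_subset) auto
qed

lemma l_coset_carrier_prod:
  assumes "a \<in> carrier R" "ideal B R"
  shows "(a <# carrier R) \<cdot> B = a <# B"
proof
  have B: "B \<subseteq> carrier R" using assms ideal_carrier by blast
  show "(a <# carrier R) \<cdot> B \<subseteq> a <# B"
  proof (intro ideal_prod_least ideal_l_coset)
    fix i j assume "i \<in> a <# carrier R" and j: "j \<in> B"
    then obtain y where y: "y \<in> carrier R" "i = a \<otimes> y" by (auto simp: l_coset_def)
    then have "i \<otimes> j = a \<otimes> (y \<otimes> j)" using assms(1) B j m_assoc by blast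
    then show "i \<otimes> j \<in> a <# B"
      using ideal.I_l_closed[OF assms(2) j y(1)] by (auto simp: l_coset_def)
  qed (use assms in auto)
  show "a <# B \<subseteq> (a <# carrier R) \<cdot> B"
  proof
    fix z assume "z \<in> a <# B"
    then obtain b where b: "b \<in> B" "z = a \<otimes> b" by (auto simp: l_coset_def)
    moreover have "a \<in> a <# carrier R" using assms by (auto simp: l_coset_def intro!: bexI[of _ \<one>])
    ultimately show "z \<in> (a <# carrier R) \<cdot> B" by (auto intro: ideal_prod.prod)
  qed
qed

lemma set_add_assoc:
  assumes "ideal A R" "ideal B R" "ideal C R"
  shows "A <+> B <+> C = A <+> (B <+> C)"
  using assms by (simp add: add.set_mult_assoc ideal_carrier set_add_defs(1))

lemma set_add_commute: "ideal A R \<Longrightarrow> ideal B R \<Longrightarrow> A <+> B = B <+> A"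
  by (metis sup_commute union_genideal)

lemma ideal_prod_mem: "i \<in> I \<Longrightarrow> j \<in> J \<Longrightarrow> i \<otimes> j \<in> I \<cdot> J"
  by (rule ideal_prod.prod)

lemma genideal_empty: "Idl {} = {\<zero>}"
  using genideal_minimal[OF zeroideal, of "{}"] ideal_zero[OF genideal_ideal[of "{}"]] by auto

text \<open>The subquotient is an image of a direct sum of copies of \<open>B / C\<close>, one for
  each generator. The summand \<open>Z\<close> is arbitrary because in the induction it has to
  absorb \<open>a C\<close> for the generator \<open>a\<close> split off.\<close>

lemma ideal_length_prod_le:
  assumes "set as \<subseteq> carrier R" "ideal B R" "ideal C R" "ideal Z R" "C \<subseteq> B"
  shows "ideal_length R ((Idl (set as)) \<cdot> C <+> Z) ((Idl (set as)) \<cdot> B <+> Z)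
    \<le> of_nat (length as) * ideal_length R C B"
  using assms
proof (induction as arbitrary: Z)
  case Nil
  then have "(Idl (set [])) \<cdot> I = {\<zero>}" if "ideal I R" for I
    using that ideal_prod_zero ideal_prod_commute zeroideal by (simp add: genideal_empty)
  with Nil show ?case by (simp add: ideal_length_self)
next
  case (Cons a as)
  define A where "A = Idl (set as)"
  have a: "a \<in> carrier R" and A: "ideal A R"
    using Cons.prems by (auto simp: A_def genideal_ideal)
  have gen: "Idl (set (a # as)) = (a <# carrier R) <+> A"
    using genideal_insert Cons.prems by (simp add: A_def)
  have prod: "(Idl (set (a # as))) \<cdot> I = (a <# I) <+> A \<cdot> I" if "ideal I R" for I
    unfolding gen using that a A
    by (simp add: ideal_prod_distr(2) ideal_l_coset oneideal l_coset_carrier_prod)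
  note i = ideal_l_coset[OF _ a] ideal_prod_is_ideal add_ideals
  \<comment> \<open>The intermediate ideal is \<open>a C + A B + Z\<close>. Below it the induction
    hypothesis applies with \<open>Z'\<close> for \<open>Z\<close>; above it only multiplication by
    \<open>a\<close> matters.\<close>
  define Y where "Y = A \<cdot> B <+> Z"
  define Z' where "Z' = (a <# C) <+> Z"
  have iY: "ideal Y R" "ideal Z' R" using Cons.prems A by (auto simp: Y_def Z'_def intro: i)
  have *: "ideal_length R ((a <# C) <+> Y) ((a <# B) <+> Y) \<le> ideal_length R C B"
  proof -
    have "(a <# B) <+> ((a <# C) <+> Y) = (a <# B) <+> Y"
    proof -
      have "(a <# B) <+> ((a <# C) <+> Y) = ((a <# B) <+> (a <# C)) <+> Y"
        using Cons.prems iY by (simp add: set_add_assoc i)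
      also have "(a <# B) <+> (a <# C) = a <# B"
        using Cons.prems by (intro set_add_absorb i) (auto simp: l_coset_def)
      finally show ?thesis .
    qed
    moreover have "ideal_length R ((a <# C) <+> Y) ((a <# B) <+> ((a <# C) <+> Y)) \<le> ideal_length R C B"
      using Cons.prems iY a set_add_upper1[OF ideal_l_coset[OF Cons.prems(3) a] iY(1)]
      by (intro ideal_length_l_coset_le i) (auto simp: l_coset_def)
    ultimately show ?thesis by simp
  qed
  have "ideal_length R (A \<cdot> C <+> Z') (A \<cdot> B <+> Z') \<le> of_nat (length as) * ideal_length R C B"
    using Cons.IH[of Z'] Cons.prems iY by (simp add: A_def)
  moreover have swap: "A \<cdot> I <+> Z' = ((a <# C) <+> A \<cdot> I) <+> Z" if "ideal I R" for I
    unfolding Z'_def using Cons.prems A that set_add_commute[of "A \<cdot> I" "a <# C"]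
    by (simp add: i flip: set_add_assoc)
  moreover have "A \<cdot> B <+> Z' = (a <# C) <+> Y"
    unfolding swap[OF Cons.prems(2)] Y_def using Cons.prems A by (simp add: set_add_assoc i)
  ultimately have 2: "ideal_length R (((a <# C) <+> A \<cdot> C) <+> Z) ((a <# C) <+> Y)
      \<le> of_nat (length as) * ideal_length R C B" using Cons.prems(3) by simp
  have "((a <# B) <+> A \<cdot> B) <+> Z = (a <# B) <+> Y"
    unfolding Y_def using Cons.prems A by (simp add: set_add_assoc i)
  then have "ideal_length R (((a <# C) <+> A \<cdot> C) <+> Z) (((a <# B) <+> A \<cdot> B) <+> Z)
     = ideal_length R (((a <# C) <+> A \<cdot> C) <+> Z) ((a <# C) <+> Y)
       + ideal_length R ((a <# C) <+> Y) ((a <# B) <+> Y)"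
  proof (simp, intro ideal_length_add)
    show "(a <# C) <+> Y \<subseteq> (a <# B) <+> Y"
      using Cons.prems by (intro set_add_mono) (auto simp: l_coset_def)
    have "((a <# C) <+> A \<cdot> C) <+> Z = (a <# C) <+> (A \<cdot> C <+> Z)"
      using Cons.prems A by (simp add: set_add_assoc i)
    also have "\<dots> \<subseteq> (a <# C) <+> Y"
      unfolding Y_def using Cons.prems by (intro set_add_mono ideal_prod_mono) auto
    finally show "((a <# C) <+> A \<cdot> C) <+> Z \<subseteq> (a <# C) <+> Y" .
  qed (use Cons.prems A iY in \<open>auto intro: i\<close>)
  also have "\<dots> \<le> of_nat (length as) * ideal_length R C B + ideal_length R C B"
    using 2 * by (rule add_mono)
  finally show ?case
    unfolding prod[OF Cons.prems(2)] prod[OF Cons.prems(3)] by (simp add: distrib_right add.commute)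
qed

end

section \<open>Hilbert functions of graded modules\<close>

text \<open>A family of ideals \<open>D\<close> with \<open>x D\<^sub>n \<subseteq> D\<^sub>n\<^sub>+\<^sub>1\<close> for \<open>x\<close> in the list \<open>xs\<close> is a graded submodule
  of \<open>R[t]\<close> over the polynomial ring whose variables act as multiplication by \<open>x t\<close>. All graded modules
  below are subquotients \<open>B / C\<close> of \<open>R[t]\<close>: this class is closed under taking the kernel and cokernel
  of a variable.\<close>

definition graded_submodule :: "('a, 'b) ring_scheme \<Rightarrow> 'a list \<Rightarrow> (nat \<Rightarrow> 'a set) \<Rightarrow> bool" where
  "graded_submodule R xs D \<longleftrightarrow>
    (\<forall>n. ideal (D n) R) \<and> (\<forall>n. \<forall>x\<in>set xs. \<forall>a\<in>D n. x \<otimes>\<^bsub>R\<^esub> a \<in> D (Suc n))"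

text \<open>Graded submodules are compared degree by degree, and the index from which a chain is
  constant must serve all degrees at once.\<close>

definition graded_noetherian ::
    "('a, 'b) ring_scheme \<Rightarrow> 'a list \<Rightarrow> (nat \<Rightarrow> 'a set) \<Rightarrow> (nat \<Rightarrow> 'a set) \<Rightarrow> bool" where
  "graded_noetherian R xs C B \<longleftrightarrow>
    (\<forall>D :: nat \<Rightarrow> nat \<Rightarrow> 'a set. mono D \<longrightarrow> (\<forall>k. graded_submodule R xs (D k) \<and> C \<le> D k \<and> D k \<le> B) \<longrightarrow>
      (\<exists>k0. \<forall>k\<ge>k0. D k = D k0))"

text \<open>The graded module \<open>x B + C\<close>; modulo it \<open>B\<close> becomes the
  cokernel of the variable \<open>x\<close> on \<open>B / C\<close>. Nothing is shifted into degree
  zero.\<close>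

definition graded_shift ::
    "('a, 'b) ring_scheme \<Rightarrow> 'a \<Rightarrow> (nat \<Rightarrow> 'a set) \<Rightarrow> (nat \<Rightarrow> 'a set) \<Rightarrow> nat \<Rightarrow> 'a set" where
  "graded_shift R x B C n = (case n of 0 \<Rightarrow> C 0 | Suc m \<Rightarrow> (x <#\<^bsub>R\<^esub> B m) <+>\<^bsub>R\<^esub> C (Suc m))"

lemma graded_shift_simps [simp]:
  "graded_shift R x B C 0 = C 0"
  "graded_shift R x B C (Suc m) = (x <#\<^bsub>R\<^esub> B m) <+>\<^bsub>R\<^esub> C (Suc m)"
  by (simp_all add: graded_shift_def)

lemma graded_noetherianD:
  fixes D :: "nat \<Rightarrow> nat \<Rightarrow> 'a set"
  assumes "graded_noetherian R xs C B" "mono D"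
    and "\<And>k. graded_submodule R xs (D k)" "\<And>k. C \<le> D k" "\<And>k. D k \<le> B"
  obtains k0 where "\<And>k. k \<ge> k0 \<Longrightarrow> D k = D k0"
proof -
  have "\<exists>k0. \<forall>k\<ge>k0. D k = D k0"
    using assms(1)[unfolded graded_noetherian_def, rule_format, of D] assms(2-) by blast
  then show ?thesis using that by blast
qed

lemma graded_noetherian_subquotient:
  assumes "graded_noetherian R xs C B" "C \<le> C'" "B' \<le> B"
    and "\<And>D. graded_submodule R ys D \<Longrightarrow> C' \<le> D \<Longrightarrow> D \<le> B' \<Longrightarrow> graded_submodule R xs D"
  shows "graded_noetherian R ys C' B'"
  unfolding graded_noetherian_def
proof (intro allI impI)
  fix D :: "nat \<Rightarrow> nat \<Rightarrow> 'a set"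
  assume m: "mono D" and D: "\<forall>k. graded_submodule R ys (D k) \<and> C' \<le> D k \<and> D k \<le> B'"
  have 1: "graded_submodule R xs (D k)" for k using D assms(4) by blast
  have 2: "C \<le> D k" for k using D assms(2) order_trans by blast
  have 3: "D k \<le> B" for k using D assms(3) order_trans by blast
  from graded_noetherianD[OF assms(1) m 1 2 3] show "\<exists>k0. \<forall>k\<ge>k0. D k = D k0" by metis
qed

text \<open>The diagonal of a doubly increasing family controls all but finitely many of its rows.\<close>

lemma double_chain_stabilizes:
  fixes E :: "nat \<Rightarrow> nat \<Rightarrow> 'a::order"
  assumes mono: "\<And>k j k' j'. k \<le> k' \<Longrightarrow> j \<le> j' \<Longrightarrow> E k j \<le> E k' j'"
    and diag: "\<exists>i. \<forall>j\<ge>i. E j j = E i i"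
    and rows: "\<And>k. \<exists>i. \<forall>j\<ge>i. E k j = E k i"
  shows "\<exists>i. \<forall>k. \<forall>j\<ge>i. E k j = E k i"
proof -
  from diag obtain m where m: "\<And>j. j \<ge> m \<Longrightarrow> E j j = E m m" by blast
  from rows obtain f where f: "\<And>k j. j \<ge> f k \<Longrightarrow> E k j = E k (f k)" by metis
  \<comment> \<open>The sum bounds the stabilization index of each of the finitely many rows below
    \<open>m\<close>.\<close>
  define i where "i = m + (\<Sum>k<m. f k)"
  have "E k j = E k i" if "j \<ge> i" for k j
  proof (cases "k < m")
    case True
    then have "f k \<le> (\<Sum>k<m. f k)" by (intro member_le_sum) auto
    then have "f k \<le> i" by (simp add: i_def)
    with that show ?thesis using f[of k j] f[of k i] by simp
  next
    case False
    \<comment> \<open>For a row beyond \<open>m\<close> the entry is squeezed between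
      \<open>E m m\<close> and a later diagonal entry.\<close>
    have *: "E k j = E m m" if "j \<ge> m" for j
    proof (rule antisym)
      show "E m m \<le> E k j" using mono False that by simp
      have "E k j \<le> E (max k j) (max k j)" by (intro mono) auto
      also have "\<dots> = E m m" using that by (intro m) auto
      finally show "E k j \<le> E m m" .
    qed
    show ?thesis using *[of j] *[of i] that by (simp add: i_def)
  qed
  then show ?thesis by blast
qed

text \<open>The union of the chain is one of its members, and no later member can exceed it.\<close>

lemma (in noetherian_ring) ideal_sequence_stabilizes:
  assumes "mono A" "\<And>k. ideal (A k) R"
  shows "\<exists>k0. \<forall>k\<ge>(k0::nat). A k = A k0"
proof -
  have "\<Union>(range A) \<in> range A"
  proof (rule ideal_chain_is_trivial)
    show "subset.chain {I. ideal I R} (range A)"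
      unfolding subset_chain_def
    proof (intro conjI ballI)
      fix I J assume "I \<in> range A" "J \<in> range A"
      then obtain k j where "I = A k" "J = A j" by blast
      then show "I \<subseteq> J \<or> J \<subseteq> I"
        using monoD[OF assms(1), of k j] monoD[OF assms(1), of j k] linear[of k j] by blast
    qed (use assms(2) in auto)
  qed auto
  then obtain k0 where k0: "\<Union>(range A) = A k0" by blast
  have "A k = A k0" if "k \<ge> k0" for k
    using k0 monoD[OF assms(1) that] by blast
  then show ?thesis by blast
qed

context cring
begin

lemma graded_submoduleD:
  assumes "graded_submodule R xs D"
  shows "ideal (D n) R" "x \<in> set xs \<Longrightarrow> a \<in> D n \<Longrightarrow> x \<otimes> a \<in> D (Suc n)"
  using assms by (auto simp: graded_submodule_def)

lemma graded_colon:
  assumes "x \<in> carrier R" "set xs \<subseteq> carrier R" "graded_submodule R xs B" "graded_submodule R xs D"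
  shows "graded_submodule R xs (\<lambda>n. {b \<in> B n. x \<otimes> b \<in> D (Suc n)})"
  unfolding graded_submodule_def
proof (intro conjI allI ballI)
  fix n
  show "ideal {b \<in> B n. x \<otimes> b \<in> D (Suc n)} R"
    using assms graded_submoduleD(1) by (intro ideal_colon) auto
  fix y a assume y: "y \<in> set xs" and a: "a \<in> {b \<in> B n. x \<otimes> b \<in> D (Suc n)}"
  have "a \<in> carrier R" using a ideal.Icarr[OF graded_submoduleD(1)[OF assms(3)], of a n] by simp
  then have "x \<otimes> (y \<otimes> a) = y \<otimes> (x \<otimes> a)" using y assms(1,2) m_lcomm[of x y a] by auto
  then show "y \<otimes> a \<in> {b \<in> B (Suc n). x \<otimes> b \<in> D (Suc (Suc n))}"
    using a y graded_submoduleD(2)[OF assms(3)] graded_submoduleD(2)[OF assms(4)] by simp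
qed

lemma graded_submodule_shift:
  assumes "x \<in> carrier R" "set xs \<subseteq> carrier R" "graded_submodule R xs B" "graded_submodule R xs C"
  shows "graded_submodule R xs (graded_shift R x B C)"
  unfolding graded_submodule_def
proof (intro conjI allI ballI)
  have iB: "ideal (x <# B n) R" and iC: "ideal (C n) R" for n
    using assms graded_submoduleD(1) by (auto intro: ideal_l_coset)
  fix n
  show "ideal (graded_shift R x B C n) R" using iB iC by (cases n) (auto intro: add_ideals)
  fix y a assume y: "y \<in> set xs" and a: "a \<in> graded_shift R x B C n"
  have yc: "y \<in> carrier R" using y assms(2) by blast
  show "y \<otimes> a \<in> graded_shift R x B C (Suc n)"
  proof (cases n)
    case 0
    then have "y \<otimes> a \<in> C (Suc n)" using a y graded_submoduleD(2)[OF assms(4)] by auto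
    then show ?thesis using set_add_upper2[OF iB iC] by auto
  next
    case (Suc m)
    with a obtain b c where bc: "b \<in> B m" "c \<in> C n" "a = x \<otimes> b \<oplus> c"
      by (auto simp: mem_set_add l_coset_def)
    have "b \<in> carrier R" "c \<in> carrier R"
      using bc graded_submoduleD(1)[OF assms(3), of m] graded_submoduleD(1)[OF assms(4), of n]
      by (auto intro: ideal.Icarr)
    then have "y \<otimes> a = x \<otimes> (y \<otimes> b) \<oplus> y \<otimes> c"
      unfolding bc(3) using assms(1) yc by (simp add: r_distr m_lcomm)
    moreover have "y \<otimes> b \<in> B n" "y \<otimes> c \<in> C (Suc n)"
      using bc y Suc graded_submoduleD(2)[OF assms(3)] graded_submoduleD(2)[OF assms(4)] by auto
    ultimately show ?thesis by (auto simp: mem_set_add l_coset_def)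
  qed
qed

lemma graded_shift_mono:
  assumes "C \<le> D"
  shows "graded_shift R x B C \<le> graded_shift R x B D"
proof (rule le_funI)
  fix n show "graded_shift R x B C n \<subseteq> graded_shift R x B D n"
    using assms by (cases n) (simp_all add: le_fun_def set_add_mono)
qed

lemma graded_shift_least:
  assumes "graded_submodule R (x # xs) B" "C \<le> B"
  shows "graded_shift R x B C \<le> B"
proof (rule le_funI)
  fix n show "graded_shift R x B C n \<subseteq> B n"
  proof (cases n)
    case (Suc m)
    have "x <# B m \<subseteq> B (Suc m)"
      using graded_submoduleD(2)[OF assms(1), of x] by (auto simp: l_coset_def)
    then show ?thesis
      using Suc assms(2) graded_submoduleD(1)[OF assms(1)] by (simp add: le_fun_def set_add_least)
  qed (use assms(2) in \<open>auto simp: le_fun_def\<close>)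
qed

lemma graded_shift_upper:
  assumes "x \<in> carrier R" "graded_submodule R xs B" "graded_submodule R xs C"
  shows "C \<le> graded_shift R x B C"
proof (rule le_funI)
  fix n show "C n \<subseteq> graded_shift R x B C n"
    using assms graded_submoduleD(1)
    by (cases n) (auto intro!: subsetD[OF set_add_upper2] ideal_l_coset)
qed

lemma graded_submodule_Cons:
  "graded_submodule R (x # xs) D \<longleftrightarrow> graded_submodule R xs D \<and> (\<forall>n. \<forall>a\<in>D n. x \<otimes> a \<in> D (Suc n))"
  by (auto simp: graded_submodule_def)

text \<open>Hilbert's basis theorem for graded modules over \<open>R[T\<^sub>1, \<dots>, T\<^sub>k]\<close>: replace a submodule \<open>D\<close> by the
  increasing family of the images of \<open>(D : x\<^sup>k)\<close> modulo \<open>x B\<close>.\<close>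

lemma graded_noetherian_Cons:
  assumes x: "x \<in> carrier R" and xs: "set xs \<subseteq> carrier R"
    and B: "graded_submodule R (x # xs) B" and C: "graded_submodule R (x # xs) C" and "C \<le> B"
    and noeth: "graded_noetherian R xs (graded_shift R x B C) B"
  shows "graded_noetherian R (x # xs) C B"
  unfolding graded_noetherian_def
proof (intro allI impI)
  fix D :: "nat \<Rightarrow> nat \<Rightarrow> 'a set"
  assume mD: "mono D" and D: "\<forall>k. graded_submodule R (x # xs) (D k) \<and> C \<le> D k \<and> D k \<le> B"
  define Q where "Q D = (\<lambda>n. {b \<in> B n. x \<otimes> b \<in> D (Suc n)})" for D :: "nat \<Rightarrow> 'a set"
  have Q: "graded_submodule R (x # xs) (Q D) \<and> D \<le> Q D \<and> Q D \<le> B"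
    if "graded_submodule R (x # xs) D" "D \<le> B" for D
    using graded_colon[of x "x # xs" B D] that x xs B
    by (auto simp: Q_def le_fun_def graded_submodule_Cons)
  have Q_mono: "Q D \<le> Q D'" if "D \<le> D'" for D D'
    using that by (auto simp: Q_def le_fun_def)
  \<comment> \<open>\<open>F k j\<close> is the part of \<open>B\<close> that \<open>x\<close>
    multiplied \<open>k\<close> times carries into \<open>D j\<close>.\<close>
  define F where "F k j = (Q ^^ k) (D j)" for k j
  have F0: "F 0 j = D j" and F_Suc: "F (Suc k) j = Q (F k j)" for k j by (auto simp: F_def)
  have F: "graded_submodule R (x # xs) (F k j) \<and> C \<le> F k j \<and> F k j \<le> B" for k j
  proof (induction k)
    case (Suc k)
    then show ?case using Q[of "F k j"] order_trans unfolding F_Suc by blast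
  qed (use D F0 in auto)
  have F_mono: "F k j \<le> F k' j'" if "k \<le> k'" "j \<le> j'" for k j k' j'
  proof -
    have "F k j \<le> F k j'" using monoD[OF mD \<open>j \<le> j'\<close>]
      by (induction k) (auto simp: F0 F_Suc intro: Q_mono)
    also have "\<dots> \<le> F k' j'" using \<open>k \<le> k'\<close>
    proof (induction rule: dec_induct)
      case (step m)
      then show ?case using Q[of "F m j'"] F[of m j'] order_trans unfolding F_Suc by blast
    qed simp
    finally show ?thesis .
  qed
  define E where "E k j = graded_shift R x B (F k j)" for k j
  have E_mono: "E k j \<le> E k' j'" if "k \<le> k'" "j \<le> j'" for k j k' j'
    unfolding E_def by (intro graded_shift_mono F_mono that)
  have sub: "graded_submodule R xs (E k j)" "graded_shift R x B C \<le> E k j" "E k j \<le> B" for k j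
    unfolding E_def using F[of k j] x xs B
    by (auto intro!: graded_submodule_shift graded_shift_mono graded_shift_least
        simp: graded_submodule_Cons)
  \<comment> \<open>Rows and diagonal are chains between \<open>x B + C\<close> and
    \<open>B\<close>, where fewer variables suffice, so one index serves all
    \<open>k\<close>.\<close>
  have "\<exists>i. \<forall>k. \<forall>j\<ge>i. E k j = E k i"
  proof (rule double_chain_stabilizes)
    have "mono (\<lambda>j. E j j)" by (intro monoI E_mono)
    from graded_noetherianD[OF noeth this sub] show "\<exists>i. \<forall>j\<ge>i. E j j = E i i" by metis
    fix k
    have "mono (E k)" by (intro monoI E_mono) auto
    from graded_noetherianD[OF noeth this sub] show "\<exists>i. \<forall>j\<ge>i. E k j = E k i" by metis
  qed (rule E_mono)
  then obtain i where i: "\<And>k j. j \<ge> i \<Longrightarrow> E k j = E k i" by blast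
  \<comment> \<open>Induction on the degree for all \<open>k\<close> together. Modulo
    \<open>x B\<close> an element of \<open>F k j\<close> already comes from \<open>F k i\<close>;
    the error \<open>x \<otimes> b'\<close> has \<open>b'\<close> in \<open>F (Suc k) j\<close> one
    degree lower.\<close>
  have *: "F k j n \<subseteq> F k i n" if "j \<ge> i" for k j n
  proof (induction n arbitrary: k)
    case 0
    show ?case using i[OF that, of k] by (auto simp: E_def fun_eq_iff dest!: spec[of _ 0])
  next
    case (Suc n)
    show ?case
    proof
      fix b assume b: "b \<in> F k j (Suc n)"
      have Fid: "ideal (F k j n) R" for k j n using F graded_submoduleD(1) by blast
      have Bid: "ideal (B n) R" using B graded_submoduleD(1) by blast
      have "F k j (Suc n) \<subseteq> E k j (Suc n)"
        unfolding E_def using set_add_upper2[OF ideal_l_coset[OF Bid x] Fid] by simp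
      with b i[OF that, of k] have "b \<in> E k i (Suc n)" by auto
      then obtain b' c where bc: "b' \<in> B n" "c \<in> F k i (Suc n)" "b = x \<otimes> b' \<oplus> c"
        by (auto simp: E_def mem_set_add l_coset_def)
      have carr: "b' \<in> carrier R" "c \<in> carrier R"
        using ideal.Icarr[OF Bid bc(1)] ideal.Icarr[OF Fid bc(2)] .
      have "c \<in> F k j (Suc n)" using bc(2) F_mono[of k k i j] that by (auto simp: le_fun_def)
      moreover have "c \<oplus> x \<otimes> b' \<in> F k j (Suc n)" using b bc(3) carr x a_comm by simp
      ultimately have "x \<otimes> b' \<in> F k j (Suc n)"
        using ideal_add_cancel[OF Fid, of c "x \<otimes> b'"] carr x by simp
      then have "b' \<in> F (Suc k) j n" using bc(1) by (simp add: F_Suc Q_def)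
      then have "b' \<in> F (Suc k) i n" using Suc.IH by blast
      then have "x \<otimes> b' \<in> F k i (Suc n)" by (simp add: F_Suc Q_def)
      then show "b \<in> F k i (Suc n)" using bc ideal_add[OF Fid] by simp
    qed
  qed
  have "D j = D i" if "j \<ge> i" for j
  proof (rule antisym)
    show "D j \<le> D i" using *[OF that, of 0] by (simp add: F0 le_fun_def)
    show "D i \<le> D j" using monoD[OF mD that] .
  qed
  then show "\<exists>i. \<forall>j\<ge>i. D j = D i" by blast
qed

text \<open>The last premise says that \<open>B / C\<close> is generated in degree zero, without
  forming a sum over the list. Each variable is moved into the denominator by replacing
  \<open>C\<close> with \<open>x B + C\<close>.\<close>

lemma graded_noetherian_generated:
  assumes "noetherian_ring R" "set xs \<subseteq> carrier R"
    and "graded_submodule R xs B" "graded_submodule R xs C" "C \<le> B"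
    and "\<And>n A. ideal A R \<Longrightarrow> C (Suc n) \<subseteq> A \<Longrightarrow> (\<And>x. x \<in> set xs \<Longrightarrow> x <# B n \<subseteq> A) \<Longrightarrow> B (Suc n) \<subseteq> A"
  shows "graded_noetherian R xs C B"
  using assms(2-)
proof (induction xs arbitrary: C)
  case Nil
  show ?case
    unfolding graded_noetherian_def
  proof (intro allI impI)
    fix D :: "nat \<Rightarrow> nat \<Rightarrow> 'a set"
    assume mD: "mono D" and D: "\<forall>k. graded_submodule R [] (D k) \<and> C \<le> D k \<and> D k \<le> B"
    have "mono (\<lambda>k. D k 0)" using mD by (auto simp: mono_def le_fun_def)
    with D obtain i where i: "\<And>k. k \<ge> i \<Longrightarrow> D k 0 = D i 0"
      using noetherian_ring.ideal_sequence_stabilizes[OF assms(1), of "\<lambda>k. D k 0"] graded_submoduleD(1) by blast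
    \<comment> \<open>With no variables left the quotient lives in degree zero, where the noetherian
      ring stops the chain.\<close>
    have "B (Suc n) \<subseteq> C (Suc n)" for n
      using Nil.prems(5)[of "C (Suc n)" n] graded_submoduleD(1)[OF Nil.prems(3)] by simp
    then have BD: "D k (Suc n) = B (Suc n)" for k n using D by (simp add: le_fun_def) blast
    have "D k = D i" if "k \<ge> i" for k
    proof
      fix n show "D k n = D i n" using i[OF that] BD by (cases n) auto
    qed
    then show "\<exists>i. \<forall>k\<ge>i. D k = D i" by blast
  qed
next
  case (Cons x xs)
  have x: "x \<in> carrier R" "set xs \<subseteq> carrier R" using Cons.prems(1) by auto
  have sub: "graded_submodule R xs B" "graded_submodule R xs C"
    using Cons.prems by (auto simp: graded_submodule_Cons)
  note upper = graded_shift_upper[OF x(1) sub]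
  have "graded_noetherian R xs (graded_shift R x B C) B"
  proof (rule Cons.IH)
    show "graded_shift R x B C \<le> B" using Cons.prems by (intro graded_shift_least)
    fix n A assume A: "ideal A R" "graded_shift R x B C (Suc n) \<subseteq> A" "\<And>x. x \<in> set xs \<Longrightarrow> x <# B n \<subseteq> A"
    have "x <# B n \<subseteq> graded_shift R x B C (Suc n)"
      using set_add_upper1[OF ideal_l_coset[OF _ x(1)]] sub graded_submoduleD(1) by simp
    moreover have "C (Suc n) \<subseteq> graded_shift R x B C (Suc n)" using upper le_funD by metis
    ultimately have "y \<in> set (x # xs) \<Longrightarrow> y <# B n \<subseteq> A" "C (Suc n) \<subseteq> A" for y
      using A(2,3) by (cases "y = x"; simp)+
    then show "B (Suc n) \<subseteq> A" by (intro Cons.prems(5) A(1))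
  qed (use x sub in \<open>auto intro: graded_submodule_shift\<close>)
  then show ?case using Cons.prems x by (intro graded_noetherian_Cons)
qed

text \<open>Multiplication by a variable \<open>x\<close> on \<open>B / C\<close> has kernel
  \<open>K / C\<close> and cokernel \<open>B / L\<close>, both killed by \<open>x\<close>. The
  difference of the Hilbert function is therefore a difference of two Hilbert functions over fewer
  variables.\<close>

theorem hilbert_serre:
  assumes "set xs \<subseteq> carrier R" "graded_submodule R xs B" "graded_submodule R xs C" "C \<le> B"
    and "graded_noetherian R xs C B" "\<And>n. ideal_length R (C n) (B n) \<noteq> \<infinity>"
  shows "leading (length xs) (\<lambda>n. int (the_enat (ideal_length R (C n) (B n)))) 0"
  using assms
proof (induction xs arbitrary: B C)
  case Nil
  \<comment> \<open>The chain equals \<open>B\<close> below degree \<open>k\<close> and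
    \<open>C\<close> from there on; once it is constant, \<open>B\<close> and \<open>C\<close> agree
    in all high degrees.\<close>
  define D where "D k n = (if n < k then B n else C n)" for k n
  have BC: "C n \<subseteq> B n" for n using Nil.prems(4) by (simp add: le_fun_def)
  have "mono D" using BC by (auto simp: mono_def D_def le_fun_def)
  moreover have "graded_submodule R [] (D k)" "C \<le> D k" "D k \<le> B" for k
    using Nil.prems BC by (auto simp: graded_submodule_def D_def le_fun_def)
  ultimately obtain i where i: "\<And>k. k \<ge> i \<Longrightarrow> D k = D i"
    using graded_noetherianD[OF Nil.prems(5)] by metis
  have "B n = C n" if "n \<ge> i" for n
  proof -
    have "D (Suc n) n = D n n" using i[of n] i[of "Suc n"] that by simp
    then show ?thesis by (simp add: D_def)
  qed
  then have "\<And>n. n \<ge> i \<Longrightarrow> int (the_enat (ideal_length R (C n) (B n))) = 0"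
    by (simp add: ideal_length_self flip: zero_enat_def) (simp add: zero_enat_def)
  then show ?case by (auto simp: eventually_sequentially)
next
  case (Cons x xs)
  define K where "K = (\<lambda>n. {b \<in> B n. x \<otimes> b \<in> C (Suc n)})"
  define L where "L = graded_shift R x B C"
  have x: "x \<in> carrier R" "set xs \<subseteq> carrier R" using Cons.prems(1) by auto
  have B: "graded_submodule R xs B" and C: "graded_submodule R xs C"
    using Cons.prems by (auto simp: graded_submodule_Cons)
  have K: "graded_submodule R xs K" unfolding K_def by (intro graded_colon x B C)
  have L: "graded_submodule R xs L" unfolding L_def by (intro graded_submodule_shift x B C)
  have KB: "K \<le> B" by (auto simp: K_def le_fun_def)
  have CK: "C \<le> K"
    using Cons.prems(3,4) by (auto simp: K_def le_fun_def graded_submodule_Cons)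
  have CL: "C \<le> L" unfolding L_def by (intro graded_shift_upper[OF x(1) B C])
  have LB: "L \<le> B" unfolding L_def using Cons.prems by (intro graded_shift_least)
  let ?l = "\<lambda>C B n. ideal_length R (C n) (B n)"
  have l1: "?l C B n = ?l C K n + ?l K B n" for n
    using CK KB graded_submoduleD(1) B C K by (intro ideal_length_add) (auto simp: le_fun_def)
  have l2: "?l C B n = ?l C L n + ?l L B n" for n
    using CL LB graded_submoduleD(1) B C L by (intro ideal_length_add) (auto simp: le_fun_def)
  have l3: "?l C L (Suc n) = ?l K B n" for n
    using ideal_length_colon[of "B n" "C (Suc n)" x] x B C graded_submoduleD(1) by (simp add: L_def K_def)
  have fin: "?l C K n \<noteq> \<infinity>" "?l L B n \<noteq> \<infinity>" "?l K B n \<noteq> \<infinity>" for n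
    using Cons.prems(6)[of n] l1[of n] l2[of n] by (metis plus_eq_infty_iff_enat)+
  have "leading (length xs) (\<lambda>n. int (the_enat (?l L B n))) 0"
  proof (rule Cons.IH)
    show "graded_noetherian R xs L B"
    \<comment> \<open>Any \<open>D\<close> between \<open>L\<close> and \<open>B\<close> is stable
      under \<open>x\<close>, since \<open>x B\<close> lies in \<open>L\<close>.\<close>
    proof (rule graded_noetherian_subquotient[OF Cons.prems(5) CL order_refl])
      fix D assume D: "graded_submodule R xs D" "L \<le> D" "D \<le> B"
      have "x \<otimes> a \<in> D (Suc n)" if "a \<in> D n" for a n
      proof -
        have "a \<in> B n" using D(3) that by (auto simp: le_fun_def)
        then have "x \<otimes> a \<in> x <# B n" by (auto simp: l_coset_def)
        then have "x \<otimes> a \<in> L (Suc n)"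
          unfolding L_def
          using set_add_upper1[OF ideal_l_coset[OF graded_submoduleD(1)[OF B] x(1)] graded_submoduleD(1)[OF C]]
          by auto
        then show ?thesis using D(2) by (auto simp: le_fun_def)
      qed
      with D(1) show "graded_submodule R (x # xs) D" by (simp add: graded_submodule_Cons)
    qed
  qed (use x B L LB fin in auto)
  then have 1: "leading (length xs) (\<lambda>n. int (the_enat (?l L B (Suc n)))) 0"
    using leading_shift[of "length xs" "\<lambda>n. int (the_enat (?l L B n))" 1] by simp
  have 2: "leading (length xs) (\<lambda>n. int (the_enat (?l C K n))) 0"
  proof (rule Cons.IH)
    show "graded_noetherian R xs C K"
    proof (rule graded_noetherian_subquotient[OF Cons.prems(5) order_refl KB])
      fix D assume D: "graded_submodule R xs D" "C \<le> D" "D \<le> K"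
      have "x \<otimes> a \<in> D (Suc n)" if "a \<in> D n" for a n
        using D(2,3) that by (auto simp: le_fun_def K_def)
      with D(1) show "graded_submodule R (x # xs) D" by (simp add: graded_submodule_Cons)
    qed
  qed (use x C K CK fin in auto)
  \<comment> \<open>The image of \<open>x\<close> in degree \<open>n + 1\<close> and
    \<open>B / K\<close> in degree \<open>n\<close> have equal length by \<open>l3\<close>, so they
    cancel.\<close>
  have "int (the_enat (?l C B (Suc n))) - int (the_enat (?l C B n))
      = int (the_enat (?l L B (Suc n))) - int (the_enat (?l C K n))" for n
    using fin(1)[of n] fin(2)[of "Suc n"] fin(3)[of n] unfolding l2[of "Suc n"] l1[of n] l3
    by auto
  with leading_diff[OF 1 2] show ?case by simp
qed

end

section \<open>Powers of ideals\<close>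

context cring
begin

lemma ideal_power_0 [simp]: "ideal_power R I 0 = carrier R"
  by (simp add: ideal_power_def nat_pow_def ideals_set_def)

lemma ideal_power_Suc: "ideal_power R I (Suc n) = ideal_power R I n \<cdot> I"
  by (simp add: ideal_power_def nat_pow_def ideals_set_def)

lemma ideal_power_ideal: "ideal I R \<Longrightarrow> ideal (ideal_power R I n) R"
  by (induction n) (auto simp: ideal_power_Suc oneideal ideal_prod_is_ideal)

lemma ideal_carrier_prod: "ideal I R \<Longrightarrow> carrier R \<cdot> I = I"
  by (simp add: ideal_prod_commute oneideal ideal_prod_one)

lemma ideal_power_1: "ideal I R \<Longrightarrow> ideal_power R I (Suc 0) = I"
  by (simp add: ideal_power_Suc ideal_carrier_prod)

lemma ideal_power_add:
  assumes "ideal I R"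
  shows "ideal_power R I (m + n) = ideal_power R I m \<cdot> ideal_power R I n"
  by (induction n) (use assms in \<open>simp_all add: ideal_power_Suc ideal_power_ideal ideal_prod_one ideal_prod_assoc\<close>)

lemma ideal_power_mono: "I \<subseteq> J \<Longrightarrow> ideal_power R I n \<subseteq> ideal_power R J n"
  by (induction n) (simp_all add: ideal_power_Suc ideal_prod_mono)

lemma ideal_power_antimono:
  assumes "ideal I R" "m \<le> n"
  shows "ideal_power R I n \<subseteq> ideal_power R I m"
proof -
  have "ideal_power R I n = ideal_power R I m \<cdot> ideal_power R I (n - m)"
    using assms ideal_power_add[of I m "n - m"] by simp
  then show ?thesis
    using assms ideal_prod_inter[of "ideal_power R I m" "ideal_power R I (n - m)"] ideal_power_ideal by auto
qed

lemma genideal_union: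
  assumes "S \<subseteq> carrier R" "T \<subseteq> carrier R"
  shows "Idl (S \<union> T) = Idl S <+> Idl T"
proof
  note i = genideal_ideal[OF assms(1)] genideal_ideal[OF assms(2)]
  show "Idl (S \<union> T) \<subseteq> Idl S <+> Idl T"
    using set_add_upper1[OF i] set_add_upper2[OF i] genideal_self[OF assms(1)] genideal_self[OF assms(2)]
    by (intro genideal_minimal add_ideals i) auto
  show "Idl S <+> Idl T \<subseteq> Idl (S \<union> T)"
    using assms by (intro set_add_least subset_Idl_subset genideal_ideal) auto
qed

lemma genideal_image_mult:
  assumes "a \<in> carrier R" "S \<subseteq> carrier R"
  shows "Idl ((\<lambda>s. a \<otimes> s) ` S) = a <# Idl S"
proof
  have aS: "(\<lambda>s. a \<otimes> s) ` S \<subseteq> carrier R" using assms by auto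
  show "Idl ((\<lambda>s. a \<otimes> s) ` S) \<subseteq> a <# Idl S"
    using assms genideal_self[OF assms(2)]
    by (intro genideal_minimal ideal_l_coset genideal_ideal) (auto simp: l_coset_def)
  have "Idl S \<subseteq> {b \<in> carrier R. a \<otimes> b \<in> Idl ((\<lambda>s. a \<otimes> s) ` S)}"
    using assms genideal_self[OF aS] by (intro genideal_minimal ideal_colon oneideal genideal_ideal aS) auto
  then show "a <# Idl S \<subseteq> Idl ((\<lambda>s. a \<otimes> s) ` S)" by (auto simp: l_coset_def)
qed

text \<open>Monomials of degree \<open>n + 1\<close> are separated according to whether
  \<open>a\<close> divides them.\<close>

lemma ideal_power_insert:
  assumes a: "a \<in> carrier R" and J: "ideal J R"
  defines "P \<equiv> (a <# carrier R) <+> J"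
  shows "ideal_power R P (Suc n) = ideal_power R J (Suc n) <+> (a <# ideal_power R P n)"
proof
  have aR: "ideal (a <# carrier R) R" using a by (intro ideal_l_coset oneideal)
  have P: "ideal P R" unfolding P_def by (intro add_ideals aR J)
  note i = ideal_power_ideal[OF P] ideal_power_ideal[OF J]
  have aP: "ideal (a <# ideal_power R P n) R" for n using a i by (intro ideal_l_coset)
  have JP: "J \<subseteq> P" unfolding P_def by (rule set_add_upper2[OF aR J])
  show "ideal_power R P (Suc n) \<subseteq> ideal_power R J (Suc n) <+> (a <# ideal_power R P n)"
  proof (induction n)
    case 0
    show ?case
      using set_add_commute[OF aR J] by (simp add: ideal_power_Suc ideal_carrier_prod P J) (simp add: P_def)
  next
    case (Suc n)
    let ?K = "ideal_power R J (Suc (Suc n)) <+> (a <# ideal_power R P (Suc n))"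
    have K: "ideal ?K R" by (intro add_ideals i aP)
    note up1 = set_add_upper1[OF i(2) aP] and up2 = set_add_upper2[OF i(2) aP]
    have "ideal_power R P (Suc (Suc n))
        = (a <# carrier R) \<cdot> ideal_power R P (Suc n) <+> ideal_power R P (Suc n) \<cdot> J"
      unfolding ideal_power_Suc[of P "Suc n"]
      using ideal_prod_distr(1)[OF i(1) aR J, of "Suc n"] ideal_prod_commute[OF i(1) aR, of "Suc n"]
      by (simp add: P_def)
    also have "(a <# carrier R) \<cdot> ideal_power R P (Suc n) = a <# ideal_power R P (Suc n)"
      by (intro l_coset_carrier_prod a i)
    also have "(a <# ideal_power R P (Suc n)) <+> ideal_power R P (Suc n) \<cdot> J \<subseteq> ?K"
    proof (rule set_add_least[OF K up2])
      have "ideal_power R P (Suc n) \<cdot> J \<subseteq> (ideal_power R J (Suc n) <+> (a <# ideal_power R P n)) \<cdot> J"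
        by (intro ideal_prod_mono Suc.IH order_refl)
      also have "\<dots> = ideal_power R J (Suc n) \<cdot> J <+> (a <# ideal_power R P n) \<cdot> J"
        by (intro ideal_prod_distr i aP J)
      also have "\<dots> \<subseteq> ?K"
      proof (rule set_add_least[OF K])
        show "ideal_power R J (Suc n) \<cdot> J \<subseteq> ?K" using up1[of "Suc (Suc n)" "Suc n"] by (simp add: ideal_power_Suc[of J "Suc n"])
        have "(a <# ideal_power R P n) \<cdot> J \<subseteq> a <# ideal_power R P (Suc n)"
        proof (rule ideal_prod_least[OF aP])
          fix z j assume "z \<in> a <# ideal_power R P n" and j: "j \<in> J"
          then obtain p where p: "p \<in> ideal_power R P n" "z = a \<otimes> p" by (auto simp: l_coset_def)
          have "z \<otimes> j = a \<otimes> (p \<otimes> j)"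
            unfolding p(2) using a ideal.Icarr[OF i(1) p(1)] ideal.Icarr[OF J j] by (rule m_assoc)
          moreover have "p \<otimes> j \<in> ideal_power R P (Suc n)"
            unfolding ideal_power_Suc using p(1) j JP by (intro ideal_prod_mem) auto
          ultimately show "z \<otimes> j \<in> a <# ideal_power R P (Suc n)" by (auto simp: l_coset_def)
        qed
        then show "(a <# ideal_power R P n) \<cdot> J \<subseteq> ?K" using up2 by (rule order_trans)
      qed
      finally show "ideal_power R P (Suc n) \<cdot> J \<subseteq> ?K" .
    qed
    finally show ?case .
  qed
  show "ideal_power R J (Suc n) <+> (a <# ideal_power R P n) \<subseteq> ideal_power R P (Suc n)"
  proof (rule set_add_least[OF i(1) ideal_power_mono[OF JP]])
    have "a \<in> a <# carrier R" using a by (auto simp: l_coset_def intro!: bexI[of _ \<one>])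
    then have aP': "a \<in> P" using set_add_upper1[OF aR J] by (auto simp: P_def)
    show "a <# ideal_power R P n \<subseteq> ideal_power R P (Suc n)"
    proof
      fix z assume "z \<in> a <# ideal_power R P n"
      then obtain p where p: "p \<in> ideal_power R P n" "z = a \<otimes> p" by (auto simp: l_coset_def)
      have "z = p \<otimes> a" unfolding p(2) using a ideal.Icarr[OF i(1) p(1)] by (rule m_comm)
      then show "z \<in> ideal_power R P (Suc n)"
        unfolding ideal_power_Suc using p(1) aP' by (auto intro: ideal_prod_mem)
    qed
  qed
qed

text \<open>The list consists of the monomials of degree \<open>n\<close>. Their number follows from
  Pascal's rule, as \<open>ideal_power_insert\<close> splits off those divisible by
  \<open>a\<close>.\<close>

lemma ideal_power_generators:
  assumes "set xs \<subseteq> carrier R"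
  shows "\<exists>as. set as \<subseteq> carrier R \<and> ideal_power R (Idl (set xs)) n = Idl (set as) \<and>
    length as = (n + length xs - 1) choose n"
  using assms
proof (induction xs arbitrary: n)
  case Nil
  show ?case
  proof (cases n)
    case 0
    \<comment> \<open>Power zero is the whole ring even without generators; the truncated
      \<open>0 - 1\<close> in the binomial still gives one.\<close>
    then show ?thesis by (intro exI[of _ "[\<one>]"]) (simp add: genideal_one)
  next
    case (Suc m)
    have "ideal_power R {\<zero>} n = {\<zero>}"
      unfolding Suc ideal_power_Suc by (intro ideal_prod_zero ideal_power_ideal zeroideal)
    then show ?thesis using Suc by (intro exI[of _ "[]"]) (simp add: genideal_empty)
  qed
next
  case (Cons a xs)
  have a: "a \<in> carrier R" and xs: "set xs \<subseteq> carrier R" using Cons.prems by auto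
  show ?case
  proof (induction n)
    case 0
    show ?case by (intro exI[of _ "[\<one>]"]) (simp add: genideal_one)
  next
    case (Suc n)
    then obtain bs where bs: "set bs \<subseteq> carrier R" "ideal_power R (Idl (set (a # xs))) n = Idl (set bs)"
      "length bs = (n + length (a # xs) - 1) choose n" by blast
    obtain as where as: "set as \<subseteq> carrier R" "ideal_power R (Idl (set xs)) (Suc n) = Idl (set as)"
      "length as = (Suc n + length xs - 1) choose Suc n" using Cons.IH[OF xs, of "Suc n"] by blast
    have "Idl (set (a # xs)) = (a <# carrier R) <+> Idl (set xs)"
      using genideal_insert[OF a xs] by simp
    then have "ideal_power R (Idl (set (a # xs))) (Suc n) = Idl (set as) <+> (a <# Idl (set bs))"
      using ideal_power_insert[OF a genideal_ideal[OF xs], of n] as(2) bs(2) by simp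
    also have "\<dots> = Idl (set (as @ map (\<lambda>b. a \<otimes> b) bs))"
      using as(1) bs(1) a genideal_image_mult[OF a bs(1)] genideal_union[of "set as" "(\<lambda>b. a \<otimes> b) ` set bs"]
      by auto
    finally show ?case
      using as(1,3) bs(1,3) a by (intro exI[of _ "as @ map (\<lambda>b. a \<otimes> b) bs"]) auto
  qed
qed

lemma ideal_generators:
  assumes "noetherian_ring R" "ideal I R"
  obtains as where "set as \<subseteq> carrier R" "I = Idl (set as)"
proof -
  obtain S where "S \<subseteq> carrier R" "finite S" "I = Idl S"
    using noetherian_ring.finetely_gen[OF assms] by blast
  with finite_list[of S] that show ?thesis by blast
qed

section \<open>Rees modules and the Artin-Rees theorem\<close>

lemma graded_submodule_prod:
  assumes "ideal I R" "ideal B R" "set xs \<subseteq> I"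
  shows "graded_submodule R xs (\<lambda>n. ideal_power R I n \<cdot> B)"
  unfolding graded_submodule_def
proof (intro conjI allI ballI)
  fix n
  show "ideal (ideal_power R I n \<cdot> B) R" using assms by (intro ideal_prod_is_ideal ideal_power_ideal)
  fix x a assume x: "x \<in> set xs" and a: "a \<in> ideal_power R I n \<cdot> B"
  have "x \<otimes> a \<in> I \<cdot> (ideal_power R I n \<cdot> B)" using x a assms(3) by (intro ideal_prod_mem) auto
  also have "I \<cdot> (ideal_power R I n \<cdot> B) = ideal_power R I (Suc n) \<cdot> B"
    using assms ideal_power_ideal[OF assms(1), of n]
    by (simp add: ideal_power_Suc ideal_prod_commute[of "ideal_power R I n" I] ideal_prod_assoc)
  finally show "x \<otimes> a \<in> ideal_power R I (Suc n) \<cdot> B" .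
qed

text \<open>The Rees module of \<open>B\<close> is generated by its degree zero part over the
  variables attached to the generators of \<open>I\<close>.\<close>

lemma graded_noetherian_powers:
  assumes "noetherian_ring R" "set xs \<subseteq> carrier R" "ideal B R"
  defines "I \<equiv> Idl (set xs)"
  shows "graded_noetherian R xs (\<lambda>n. {\<zero>}) (\<lambda>n. ideal_power R I n \<cdot> B)"
proof (rule graded_noetherian_generated[OF assms(1,2)])
  have I: "ideal I R" "set xs \<subseteq> I" using assms(2) genideal_ideal genideal_self by (auto simp: I_def)
  then show "graded_submodule R xs (\<lambda>n. ideal_power R I n \<cdot> B)" using assms(3) by (intro graded_submodule_prod)
  show "graded_submodule R xs (\<lambda>n. {\<zero>})"
    using assms(2) zeroideal by (auto simp: graded_submodule_def)
  have iB: "ideal (ideal_power R I n \<cdot> B) R" for n using I assms(3) by (intro ideal_prod_is_ideal ideal_power_ideal)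
  show "(\<lambda>n. {\<zero>}) \<le> (\<lambda>n. ideal_power R I n \<cdot> B)"
    using iB ideal_zero by (auto simp: le_fun_def)
  fix n A assume A: "ideal A R" "\<And>x. x \<in> set xs \<Longrightarrow> x <# (ideal_power R I n \<cdot> B) \<subseteq> A"
  have "I \<cdot> (ideal_power R I n \<cdot> B) \<subseteq> A"
  proof (rule ideal_prod_least[OF A(1)])
    fix i b assume i: "i \<in> I" and b: "b \<in> ideal_power R I n \<cdot> B"
    have bc: "b \<in> carrier R" using ideal.Icarr[OF iB b] .
    \<comment> \<open>The multipliers taking \<open>b\<close> into \<open>A\<close> form an ideal,
      so it is enough that the generators of \<open>I\<close> are among them.\<close>
    have "set xs \<subseteq> {y \<in> carrier R. b \<otimes> y \<in> A}"
    proof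
      fix x assume x: "x \<in> set xs"
      then have "x \<otimes> b \<in> A" using A(2)[OF x] b by (auto simp: l_coset_def)
      then show "x \<in> {y \<in> carrier R. b \<otimes> y \<in> A}" using x assms(2) bc m_comm[of b x] by auto
    qed
    then have "I \<subseteq> {y \<in> carrier R. b \<otimes> y \<in> A}"
      unfolding I_def by (intro genideal_minimal ideal_colon oneideal A bc)
    then show "i \<otimes> b \<in> A" using i bc m_comm[of i b] by auto
  qed
  also have "I \<cdot> (ideal_power R I n \<cdot> B) = ideal_power R I (Suc n) \<cdot> B"
    using I assms(3) ideal_power_ideal[OF I(1), of n]
    by (simp add: ideal_power_Suc ideal_prod_commute[of "ideal_power R I n" I] ideal_prod_assoc)
  finally show "ideal_power R I (Suc n) \<cdot> B \<subseteq> A" .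
qed

text \<open>\<open>hilbert_serre\<close> for the associated graded module, which is a quotient of
  the noetherian Rees module.\<close>

lemma leading_powers:
  assumes "noetherian_ring R" "set xs \<subseteq> carrier R" "ideal B R"
  defines "I \<equiv> Idl (set xs)"
  assumes fin: "\<And>n. ideal_length R (ideal_power R I (Suc n) \<cdot> B) (ideal_power R I n \<cdot> B) \<noteq> \<infinity>"
  shows "leading (length xs)
    (\<lambda>n. int (the_enat (ideal_length R (ideal_power R I (Suc n) \<cdot> B) (ideal_power R I n \<cdot> B)))) 0"
proof (rule hilbert_serre[OF assms(2) _ _ _ _ fin])
  have I: "ideal I R" "set xs \<subseteq> I" using assms(2) genideal_ideal genideal_self by (auto simp: I_def)
  show B: "graded_submodule R xs (\<lambda>n. ideal_power R I n \<cdot> B)" by (intro graded_submodule_prod I assms(3))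
  then show C: "graded_submodule R xs (\<lambda>n. ideal_power R I (Suc n) \<cdot> B)"
    unfolding graded_submodule_def by blast
  show CB: "(\<lambda>n. ideal_power R I (Suc n) \<cdot> B) \<le> (\<lambda>n. ideal_power R I n \<cdot> B)"
    using ideal_power_antimono[OF I(1)] by (simp add: le_fun_def ideal_prod_mono)
  show "graded_noetherian R xs (\<lambda>n. ideal_power R I (Suc n) \<cdot> B) (\<lambda>n. ideal_power R I n \<cdot> B)"
    using graded_noetherian_powers[OF assms(1-3)] unfolding I_def[symmetric]
  proof (rule graded_noetherian_subquotient)
    show "(\<lambda>n. {\<zero>}) \<le> (\<lambda>n. ideal_power R I (Suc n) \<cdot> B)"
      using graded_submoduleD(1)[OF C] ideal_zero by (auto simp: le_fun_def)
  qed auto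
qed

text \<open>The graded modules generated by the intersections with \<open>A\<close> up to degree
  \<open>k\<close> form an increasing chain in the noetherian Rees algebra. The constant
  \<open>c\<close> is where this chain stops.\<close>

theorem artin_rees:
  assumes "noetherian_ring R" "ideal I R" "ideal A R"
  shows "\<exists>c. \<forall>n. ideal_power R I (n + c) \<inter> A \<subseteq> ideal_power R I n \<cdot> A"
proof -
  obtain xs where xs: "set xs \<subseteq> carrier R" "I = Idl (set xs)" using ideal_generators[OF assms(1,2)] .
  have xsI: "set xs \<subseteq> I" using xs genideal_self by simp
  define P where "P n = ideal_power R I n" for n
  have P: "ideal (P n) R" for n unfolding P_def by (rule ideal_power_ideal[OF assms(2)])
  have P_Suc: "P (Suc n) = P n \<cdot> I" for n by (simp add: P_def ideal_power_Suc)
  \<comment> \<open>For \<open>n \<le> k\<close> the subtraction truncates to zero, so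
    \<open>D k n\<close> is all of \<open>P n \<inter> A\<close>; beyond degree \<open>k\<close>
    only multiples of degree \<open>k\<close> are kept.\<close>
  define D where "D k n = P (n - k) \<cdot> (P (min n k) \<inter> A)" for k n
  have PA: "ideal (P n \<inter> A) R" for n by (intro i_intersect P assms(3))
  have iD: "ideal (D k n) R" for k n unfolding D_def by (intro ideal_prod_is_ideal P PA)
  have step: "I \<cdot> (P n \<inter> A) \<subseteq> P (Suc n) \<inter> A" for n
  proof (rule ideal_prod_least[OF PA])
    fix x a assume x: "x \<in> I" and a: "a \<in> P n \<inter> A"
    have c: "x \<in> carrier R" "a \<in> carrier R" using ideal.Icarr[OF assms(2) x] ideal.Icarr[OF PA a] .
    have "a \<otimes> x \<in> P (Suc n)" unfolding P_Suc using a x by (intro ideal_prod_mem) auto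
    then show "x \<otimes> a \<in> P (Suc n) \<inter> A" using m_comm[OF c] ideal.I_l_closed[OF assms(3), of a x] a c by auto
  qed
  have D_le: "D k n = P n \<inter> A" if "n \<le> k" for k n
    using that PA by (simp add: D_def min_def P_def ideal_carrier_prod)
  have D_ge: "D k (k + m) = P m \<cdot> (P k \<inter> A)" for k m
    by (simp add: D_def min_def)
  have mono: "D k n \<subseteq> D (Suc k) n" for k n
  proof (cases "n \<le> k")
    case True
    then show ?thesis using D_le[of n k] D_le[of n "Suc k"] by simp
  next
    case False
    then obtain m where n: "n = k + Suc m" by (metis add_Suc_right less_imp_Suc_add not_le)
    have "D k n = P m \<cdot> (I \<cdot> (P k \<inter> A))"
      unfolding n D_ge P_Suc by (intro ideal_prod_assoc P PA assms(2))
    also have "\<dots> \<subseteq> P m \<cdot> (P (Suc k) \<inter> A)" by (intro ideal_prod_mono step order_refl)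
    also have "\<dots> = D (Suc k) n" using D_ge[of "Suc k" m] by (simp add: n)
    finally show ?thesis .
  qed
  have sub: "graded_submodule R xs (D k)" for k
    unfolding graded_submodule_def
  proof (intro conjI allI ballI iD)
    fix n x a assume x: "x \<in> set xs" and a: "a \<in> D k n"
    have xa: "x \<otimes> a \<in> I \<cdot> D k n" using x a xsI by (intro ideal_prod_mem) auto
    show "x \<otimes> a \<in> D k (Suc n)"
    proof (cases "n < k")
      case True
      then show ?thesis using xa step[of n] D_le[of n k] D_le[of "Suc n" k] by auto
    next
      case False
      then obtain m where n: "n = k + m" using le_Suc_ex not_le by blast
      have "I \<cdot> D k n = (I \<cdot> P m) \<cdot> (P k \<inter> A)"
        unfolding n D_ge by (intro ideal_prod_assoc[symmetric] P PA assms(2))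
      also have "I \<cdot> P m = P (Suc m)" unfolding P_Suc by (intro ideal_prod_commute P assms(2))
      also have "P (Suc m) \<cdot> (P k \<inter> A) = D k (Suc n)" using D_ge[of k "Suc m"] by (simp add: n)
      finally show ?thesis using xa by simp
    qed
  qed
  have "graded_noetherian R xs (\<lambda>n. {\<zero>}) (\<lambda>n. ideal_power R (Idl (set xs)) n \<cdot> carrier R)"
    by (intro graded_noetherian_powers assms(1) xs oneideal)
  then have "graded_noetherian R xs (\<lambda>n. {\<zero>}) P"
    using P by (simp add: xs(2)[symmetric] P_def[symmetric] ideal_prod_one)
  then obtain c where c: "\<And>k. k \<ge> c \<Longrightarrow> D k = D c"
  proof (rule graded_noetherianD)
    show "mono D" using mono by (simp add: mono_iff_le_Suc le_fun_def)
    show "(\<lambda>n. {\<zero>}) \<le> D k" for k using iD ideal_zero by (auto simp: le_fun_def)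
    show "D k \<le> P" for k
    proof (rule le_funI)
      fix n
      have "D k n \<subseteq> P (n - k) \<cdot> P (min n k)" unfolding D_def by (intro ideal_prod_mono) auto
      also have "\<dots> = P n" by (simp add: P_def min_def flip: ideal_power_add[OF assms(2)])
      finally show "D k n \<subseteq> P n" .
    qed
  qed (use sub in auto)
  have "P (n + c) \<inter> A \<subseteq> P n \<cdot> A" for n
  proof -
    have "P (n + c) \<inter> A = D c (c + n)" using D_le[of "n + c" "n + c"] c[of "n + c"] by (simp add: add.commute)
    also have "\<dots> \<subseteq> P n \<cdot> A" unfolding D_ge by (intro ideal_prod_mono) auto
    finally show ?thesis .
  qed
  then show ?thesis unfolding P_def by blast
qed

text \<open>Each successive quotient of powers of \<open>I\<close> is an image of finitely many
  copies of \<open>R / I\<close>.\<close>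

lemma ideal_length_power_finite:
  assumes "noetherian_ring R" "ideal I R" "ideal_length R I (carrier R) \<noteq> \<infinity>"
  shows "ideal_length R (ideal_power R I n) (carrier R) \<noteq> \<infinity>"
proof (induction n)
  case 0
  then show ?case by (simp add: ideal_length_self)
next
  case (Suc n)
  note P = ideal_power_ideal[OF assms(2)]
  obtain as where as: "set as \<subseteq> carrier R" "ideal_power R I n = Idl (set as)"
    using ideal_generators[OF assms(1) P] .
  have "ideal_length R (ideal_power R I n \<cdot> I <+> {\<zero>}) (ideal_power R I n \<cdot> carrier R <+> {\<zero>})
      \<le> of_nat (length as) * ideal_length R I (carrier R)"
    unfolding as(2) using as(1) assms(2) ideal_carrier
    by (intro ideal_length_prod_le oneideal zeroideal) auto
  then have "ideal_length R (ideal_power R I (Suc n)) (ideal_power R I n) \<le> of_nat (length as) * ideal_length R I (carrier R)"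
    using P by (simp add: set_add_absorb zeroideal ideal_zero ideal_prod_one ideal_power_Suc[symmetric] ideal_prod_is_ideal assms(2))
  moreover have "of_nat (length as) * ideal_length R I (carrier R) \<noteq> \<infinity>"
    using assms(3) by (auto simp: of_nat_eq_enat)
  ultimately have "ideal_length R (ideal_power R I (Suc n)) (ideal_power R I n) \<noteq> \<infinity>"
    by (metis enat_ord_simps(5))
  moreover have "ideal_length R (ideal_power R I (Suc n)) (carrier R)
      = ideal_length R (ideal_power R I (Suc n)) (ideal_power R I n) + ideal_length R (ideal_power R I n) (carrier R)"
    using P ideal_carrier ideal_power_antimono[OF assms(2)] by (intro ideal_length_add oneideal) auto
  ultimately show ?case using Suc by (simp add: plus_eq_infty_iff_enat)
qed

text \<open>Submodules of \<open>R / I\<close> and ideals containing \<open>I\<close> correspond.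
  Taking preimages and images both preserve strict inclusions, so chains of the same lengths exist
  on both sides.\<close>

lemma module_length_quotient:
  assumes I: "ideal I R"
  shows "module_length R (quotient_module R I) = ideal_length R I (carrier R)"
proof -
  define M where "M = quotient_module R I"
  interpret I: ideal I R by (rule I)
  interpret M: module R M unfolding M_def by (rule quotient_module_is_module[OF I])
  have carr: "carrier M = (\<lambda>a. I +> a) ` carrier R"
    by (auto simp: M_def quotient_module_def ring.defs module.defs FactRing_def A_RCOSETS_def' )
  have add: "(I +> a) \<oplus>\<^bsub>M\<^esub> (I +> b) = I +> (a \<oplus> b)" if "a \<in> carrier R" "b \<in> carrier R" for a b
    using that by (simp add: M_def quotient_module_def ring.defs module.defs FactRing_def I.a_rcos_sum)
  have smult: "x \<odot>\<^bsub>M\<^esub> (I +> a) = I +> (x \<otimes> a)" if "a \<in> carrier R" "x \<in> carrier R" for a x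
    using that by (simp add: M_def quotient_module_def ring.defs module.defs FactRing_def I.rcoset_mult_add)
  have zero: "\<zero>\<^bsub>M\<^esub> = I +> \<zero>"
    using I.a_subset by (simp add: M_def quotient_module_def ring.defs module.defs FactRing_def)
  define pre where "pre H = {a \<in> carrier R. I +> a \<in> H}" for H
  define im where "im L = (\<lambda>a. I +> a) ` L" for L
  have pre: "ideal (pre H) R" "I \<subseteq> pre H" "pre H \<subseteq> carrier R" if H: "submodule H R M" for H
  proof -
    note HE = M.submoduleE[OF H]
    interpret H: subgroup H "add_monoid M" using H submodule.axioms(1) by blast
    have z: "I +> \<zero> \<in> H" using H.one_closed zero by simp
    show "ideal (pre H) R"
    proof (rule idealI')
      show l: "x \<otimes> a \<in> pre H" if "a \<in> pre H" "x \<in> carrier R" for a x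
        using that HE(4)[of x "I +> a"] smult by (auto simp: pre_def)
      show "a \<otimes> x \<in> pre H" if "a \<in> pre H" "x \<in> carrier R" for a x
        using l[OF that] that m_comm[of a x] by (auto simp: pre_def)
      show "a \<oplus> b \<in> pre H" if "a \<in> pre H" "b \<in> pre H" for a b
        using that HE(5)[of "I +> a" "I +> b"] add by (auto simp: pre_def)
    qed (use z in \<open>auto simp: pre_def\<close>)
    show "I \<subseteq> pre H"
    proof
      fix a assume a: "a \<in> I"
      then have "I +> a = I +> \<zero>" using I.a_rcos_const I.a_subset by simp
      then show "a \<in> pre H" using z I.a_subset a by (auto simp: pre_def)
    qed
  qed (auto simp: pre_def)
  have pre_strict: "pre H \<subset> pre H'" if H: "submodule H R M" "submodule H' R M" "H \<subset> H'" for H H'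
  proof -
    obtain z where z: "z \<in> H'" "z \<notin> H" using H(3) by blast
    then obtain a where "a \<in> carrier R" "z = I +> a" using M.submoduleE(1)[OF H(2)] carr by blast
    with z have "a \<in> pre H'" "a \<notin> pre H" by (auto simp: pre_def)
    moreover have "pre H \<subseteq> pre H'" using H(3) by (auto simp: pre_def)
    ultimately show ?thesis by blast
  qed
  have im: "submodule (im L) R M" if L: "ideal L R" for L
  proof (rule M.submoduleI)
    have Lc: "a \<in> carrier R" if "a \<in> L" for a using ideal.Icarr[OF L that] .
    show "im L \<subseteq> carrier M" using Lc by (auto simp: im_def carr)
    show "\<zero>\<^bsub>M\<^esub> \<in> im L" using ideal_zero[OF L] zero by (auto simp: im_def)
    show "z \<oplus>\<^bsub>M\<^esub> w \<in> im L" if "z \<in> im L" "w \<in> im L" for z w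
      using that add Lc ideal_add[OF L] by (fastforce simp: im_def)
    show sm: "x \<odot>\<^bsub>M\<^esub> z \<in> im L" if "x \<in> carrier R" "z \<in> im L" for x z
      using that smult Lc ideal.I_l_closed[OF L] by (fastforce simp: im_def)
    show "\<ominus>\<^bsub>M\<^esub> z \<in> im L" if "z \<in> im L" for z
    proof -
      obtain a where a: "a \<in> L" "z = I +> a" using \<open>z \<in> im L\<close> by (auto simp: im_def)
      have "(I +> \<ominus> a) \<oplus>\<^bsub>M\<^esub> (I +> a) = \<zero>\<^bsub>M\<^esub>" using add zero Lc[OF a(1)] l_neg by simp
      then have "\<ominus>\<^bsub>M\<^esub> z = I +> \<ominus> a" unfolding a(2) using Lc[OF a(1)] carr by (intro M.minus_equality) auto
      then show ?thesis using ideal_neg[OF L a(1)] by (auto simp: im_def)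
    qed
  qed
  have im_strict: "im L \<subset> im L'" if L: "ideal L R" "ideal L' R" "I \<subseteq> L" "L \<subset> L'" for L L'
  proof -
    obtain a where a: "a \<in> L'" "a \<notin> L" using L(4) by blast
    have ac: "a \<in> carrier R" using ideal.Icarr[OF L(2) a(1)] .
    have "I +> a \<notin> im L"
    proof
      assume "I +> a \<in> im L"
      then obtain b where b: "b \<in> L" "I +> a = I +> b" by (auto simp: im_def)
      have "a \<in> I +> b" using I.a_rcos_self[OF ac] b(2) by simp
      then obtain i where "i \<in> I" "a = i \<oplus> b" by (auto simp: a_r_coset_def')
      then show False using a(2) b(1) L(3) ideal_add[OF L(1)] by blast
    qed
    moreover have "I +> a \<in> im L'" using a by (auto simp: im_def)
    moreover have "im L \<subseteq> im L'" using L(4) by (auto simp: im_def)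
    ultimately show ?thesis by blast
  qed
  have "(\<exists>N. (\<forall>i\<le>n. submodule (N i) R M) \<and> (\<forall>i<n. N i \<subset> N (Suc i))) \<longleftrightarrow>
      (\<exists>N. ideal_chain R I (carrier R) n N)" (is "?l \<longleftrightarrow> ?r") for n
  proof
    assume ?l
    then obtain N where N: "\<forall>i\<le>n. submodule (N i) R M" "\<forall>i<n. N i \<subset> N (Suc i)" by blast
    then have "ideal_chain R I (carrier R) n (\<lambda>i. pre (N i))"
      unfolding ideal_chain_def using pre pre_strict by simp
    then show ?r by blast
  next
    assume ?r
    then obtain N where N: "ideal_chain R I (carrier R) n N" by blast
    then have "\<forall>i\<le>n. submodule (im (N i)) R M" "\<forall>i<n. im (N i) \<subset> im (N (Suc i))"
      unfolding ideal_chain_def using im im_strict by simp_all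
    then show ?l by (intro exI[of _ "\<lambda>i. im (N i)"] conjI)
  qed
  then show ?thesis unfolding module_length_def ideal_length_def M_def by simp
qed

end

section \<open>Dimension and reductions of the maximal ideal\<close>

text \<open>Zorn's lemma; the union of a chain of proper ideals is a member of the chain, hence
  proper.\<close>

lemma (in noetherian_ring) exists_maximalideal:
  assumes "ideal I R" "I \<noteq> carrier R"
  shows "\<exists>M. maximalideal M R \<and> I \<subseteq> M"
proof -
  define F where "F = {J. ideal J R \<and> I \<subseteq> J \<and> J \<noteq> carrier R}"
  have "\<exists>M\<in>F. \<forall>J\<in>F. M \<subseteq> J \<longrightarrow> J = M"
  proof (rule subset_Zorn_nonempty)
    fix C assume C: "C \<noteq> {}" "subset.chain F C"
    then have "subset.chain {I. ideal I R} C" by (auto simp: F_def subset_chain_def)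
    then show "\<Union>C \<in> F" using ideal_chain_is_trivial[OF C(1)] C(2) by (auto simp: subset_chain_def)
  qed (use assms in \<open>auto simp: F_def\<close>)
  then obtain M where M: "M \<in> F" "\<And>J. J \<in> F \<Longrightarrow> M \<subseteq> J \<Longrightarrow> J = M" by blast
  have "maximalideal M R"
  proof (rule maximalidealI)
    fix J assume "ideal J R" "M \<subseteq> J" "J \<subseteq> carrier R"
    then show "J = M \<or> J = carrier R" using M(1) M(2)[of J] by (auto simp: F_def)
  qed (use M in \<open>auto simp: F_def\<close>)
  with M(1) show ?thesis by (auto simp: F_def)
qed

section \<open>Chains of primes and growth of colength\<close>

context cring
begin

text \<open>Artin-Rees for \<open>A = (x) + Q\<close> writes the part of
  \<open>x \<otimes> b\<close> in the high power as \<open>x \<otimes> u \<oplus> q\<close> with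
  \<open>u \<in> ideal_power R I n\<close> and \<open>q \<in> Q\<close>. Then
  \<open>x \<otimes> (b \<ominus> u)\<close> lies in the prime \<open>Q\<close>, which does not
  contain \<open>x\<close>.\<close>

lemma prime_colon_bound:
  assumes "noetherian_ring R" "ideal I R" "primeideal Q R" "x \<in> carrier R" "x \<notin> Q"
  shows "\<exists>c. \<forall>n. {b \<in> carrier R. x \<otimes> b \<in> Q <+> ideal_power R I (n + c)} \<subseteq> Q <+> ideal_power R I n"
proof -
  interpret Q: primeideal Q R by (rule assms(3))
  have Q: "ideal Q R" by (rule Q.is_ideal)
  have xR: "ideal (x <# carrier R) R" by (intro ideal_l_coset oneideal assms(4))
  define A where "A = (x <# carrier R) <+> Q"
  have A: "ideal A R" unfolding A_def by (intro add_ideals xR Q)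
  note P = ideal_power_ideal[OF assms(2)]
  obtain c where c: "\<And>n. ideal_power R I (n + c) \<inter> A \<subseteq> ideal_power R I n \<cdot> A"
    using artin_rees[OF assms(1,2) A] by blast
  have "b \<in> Q <+> ideal_power R I n"
    if b: "b \<in> carrier R" "x \<otimes> b \<in> Q <+> ideal_power R I (n + c)" for b n
  proof -
    obtain p v where pv: "p \<in> Q" "v \<in> ideal_power R I (n + c)" "x \<otimes> b = p \<oplus> v"
      using b(2) by (auto simp: mem_set_add)
    have carr: "p \<in> carrier R" "v \<in> carrier R" "x \<in> carrier R" "b \<in> carrier R"
      using Q.Icarr[OF pv(1)] ideal.Icarr[OF P pv(2)] assms(4) b(1) .
    have "x \<otimes> b \<in> A"
      using b(1) set_add_upper1[OF xR Q] by (auto simp: A_def l_coset_def)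
    moreover have "p \<in> A" using pv(1) set_add_upper2[OF xR Q] by (auto simp: A_def)
    ultimately have "v \<in> A" using ideal_add_cancel[OF A, of p v] carr pv(3) by simp
    with pv(2) c have "v \<in> ideal_power R I n \<cdot> A" by blast
    also have "ideal_power R I n \<cdot> A = (x <# ideal_power R I n) <+> ideal_power R I n \<cdot> Q"
      unfolding A_def
      by (simp add: ideal_prod_distr(1) P xR Q ideal_prod_commute[OF P xR] l_coset_carrier_prod assms(4))
    finally obtain u q where uq: "u \<in> ideal_power R I n" "q \<in> ideal_power R I n \<cdot> Q" "v = x \<otimes> u \<oplus> q"
      by (auto simp: mem_set_add l_coset_def)
    have q: "q \<in> Q" using uq(2) ideal_prod_inter[OF P Q] by blast
    have carr': "u \<in> carrier R" "q \<in> carrier R" using ideal.Icarr[OF P uq(1)] Q.Icarr[OF q] .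
    have "x \<otimes> (b \<ominus> u) = x \<otimes> b \<ominus> x \<otimes> u" using carr carr' by algebra
    also have "\<dots> = p \<oplus> q" unfolding pv(3) uq(3) using carr carr' by algebra
    finally have "x \<otimes> (b \<ominus> u) \<in> Q" using ideal_add[OF Q pv(1) q] by simp
    then have "b \<ominus> u \<in> Q" using Q.I_prime[of x "b \<ominus> u"] assms(5) carr carr' by auto
    moreover have "b = (b \<ominus> u) \<oplus> u" using carr carr' by algebra
    ultimately show ?thesis using uq(1) unfolding mem_set_add by blast
  qed
  then show ?thesis by blast
qed

text \<open>A chain of \<open>s\<close> strict inclusions forces growth of degree at least
  \<open>s\<close>: multiplication by some \<open>x\<close> in \<open>Q 1\<close> outside
  \<open>Q 0\<close> bounds each increment below by the length modulo \<open>Q 1\<close>, which has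
  degree at least \<open>s - 1\<close>.\<close>

lemma ideal_length_prime_chain:
  assumes noeth: "noetherian_ring R" and I: "ideal I R" "I \<noteq> carrier R"
    and "\<And>i. i \<le> s \<Longrightarrow> primeideal (Q i) R" "\<And>i. i \<le> s \<Longrightarrow> Q i \<subseteq> I" "\<And>i. i < s \<Longrightarrow> Q i \<subset> Q (Suc i)"
  shows "\<exists>K>0. \<forall>n. enat (n choose s) \<le> ideal_length R (Q 0 <+> ideal_power R I (K * Suc n)) (carrier R)"
  using assms(4-)
proof (induction s arbitrary: Q)
  case 0
  have Q: "ideal (Q 0) R" using 0(1)[of 0] primeideal.axioms(1) by blast
  note P = ideal_power_ideal[OF I(1)]
  have "enat (n choose 0) \<le> ideal_length R (Q 0 <+> ideal_power R I (1 * Suc n)) (carrier R)" for n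
  proof -
    let ?C = "Q 0 <+> ideal_power R I (Suc n)"
    have C: "ideal ?C R" by (intro add_ideals Q P)
    have "ideal_power R I (Suc n) \<subseteq> I"
      using ideal_power_antimono[OF I(1), of "Suc 0" "Suc n"] ideal_power_1[OF I(1)] by simp
    then have "?C \<subseteq> I" using 0(2) by (intro set_add_least I) auto
    then have "?C \<subset> carrier R" using ideal_carrier[OF I(1)] I(2) by blast
    then have "eSuc (ideal_length R ?C ?C) \<le> ideal_length R ?C (carrier R)"
      by (intro ideal_length_strict C oneideal order_refl)
    moreover have "enat (n choose 0) = eSuc 0" by (simp add: zero_enat_def eSuc_enat)
    ultimately show ?thesis by (simp add: ideal_length_self)
  qed
  then show ?case by (intro exI[of _ 1]) simp
next
  case (Suc s)
  note P = ideal_power_ideal[OF I(1)]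
  have prime: "primeideal (Q 0) R" using Suc.prems(1)[of 0] by simp
  have Q0: "ideal (Q 0) R" and Q1: "ideal (Q 1) R"
    using Suc.prems(1)[of 0] Suc.prems(1)[of 1] primeideal.axioms(1) by auto
  obtain x where x: "x \<in> Q 1" "x \<notin> Q 0" using Suc.prems(3)[of 0] by auto
  have xc: "x \<in> carrier R" using ideal.Icarr[OF Q1 x(1)] .
  define Y where "Y n = Q 0 <+> ideal_power R I n" for n
  define Y1 where "Y1 n = Q 1 <+> ideal_power R I n" for n
  have Y: "ideal (Y n) R" "ideal (Y1 n) R" for n unfolding Y_def Y1_def by (intro add_ideals Q0 Q1 P)+
  have anti: "Y n \<subseteq> Y m" "Y1 n \<subseteq> Y1 m" if "m \<le> n" for m n
    using ideal_power_antimono[OF I(1) that] by (simp_all add: Y_def Y1_def set_add_mono)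
  obtain c where c: "\<And>n. {b \<in> carrier R. x \<otimes> b \<in> Y (n + c)} \<subseteq> Y n"
    using prime_colon_bound[OF noeth I(1) prime xc x(2)] unfolding Y_def by blast
  have "\<exists>K>0. \<forall>n. enat (n choose s) \<le> ideal_length R (Q (Suc 0) <+> ideal_power R I (K * Suc n)) (carrier R)"
    using Suc.prems by (intro Suc.IH) auto
  then obtain K1 where K1: "K1 > 0" "\<And>n. enat (n choose s) \<le> ideal_length R (Y1 (K1 * Suc n)) (carrier R)"
    unfolding Y1_def by auto
  \<comment> \<open>The ring modulo \<open>Y (n + c)\<close> is cut at
    \<open>(x) + Y (n + c)\<close>: the upper part maps onto the quotient by
    \<open>Y1 (n + c)\<close>, the lower part onto that by \<open>Y n\<close>.\<close>
  have step: "ideal_length R (Y1 (n + c)) (carrier R) + ideal_length R (Y n) (carrier R)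
      \<le> ideal_length R (Y (n + c)) (carrier R)" for n
  proof -
    let ?Y = "Y (n + c)"
    have xR: "ideal (x <# carrier R) R" by (intro ideal_l_coset oneideal xc)
    have xY: "ideal ((x <# carrier R) <+> ?Y) R" by (intro add_ideals xR Y)
    have "?Y \<subseteq> Y1 (n + c)" unfolding Y_def Y1_def using Suc.prems(3)[of 0] by (intro set_add_mono) auto
    moreover have "x <# carrier R \<subseteq> Y1 (n + c)"
      using ideal.I_r_closed[OF Q1 x(1)] set_add_upper1[OF Q1 P] by (auto simp: l_coset_def Y1_def)
    ultimately have "(x <# carrier R) <+> ?Y \<subseteq> Y1 (n + c)" by (intro set_add_least Y)
    then have 1: "ideal_length R (Y1 (n + c)) (carrier R) \<le> ideal_length R ((x <# carrier R) <+> ?Y) (carrier R)"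
      by (intro ideal_length_mono) auto
    have 2: "ideal_length R (Y n) (carrier R) \<le> ideal_length R ?Y ((x <# carrier R) <+> ?Y)"
      unfolding ideal_length_colon[OF oneideal Y(1) xc] using c by (intro ideal_length_mono) auto
    have "ideal_length R ?Y (carrier R)
        = ideal_length R ?Y ((x <# carrier R) <+> ?Y) + ideal_length R ((x <# carrier R) <+> ?Y) (carrier R)"
      by (intro ideal_length_add oneideal xY Y set_add_upper2 xR ideal_carrier)
    then show ?thesis using add_mono[OF 1 2] by (simp add: add.commute)
  qed
  \<comment> \<open>\<open>K \<ge> K1\<close> compares with the bound for \<open>Q 1\<close>, and
    \<open>K \<ge> c\<close> absorbs the shift by \<open>c\<close> in each step.\<close>
  define K where "K = K1 + c"
  have "enat (n choose Suc s) \<le> ideal_length R (Y (K * Suc n)) (carrier R)" for n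
  proof (induction n)
    case 0
    then show ?case by (simp flip: zero_enat_def)
  next
    case (Suc n)
    have "K1 * Suc n \<le> K * Suc n + c" by (simp add: K_def add_mult_distrib)
    then have "ideal_length R (Y1 (K1 * Suc n)) (carrier R) \<le> ideal_length R (Y1 (K * Suc n + c)) (carrier R)"
      by (intro ideal_length_mono anti) auto
    with K1(2)[of n] have "enat (n choose s) \<le> ideal_length R (Y1 (K * Suc n + c)) (carrier R)"
      by (rule order_trans)
    from add_mono[OF this Suc]
    have "enat (Suc n choose Suc s) \<le> ideal_length R (Y1 (K * Suc n + c)) (carrier R) + ideal_length R (Y (K * Suc n)) (carrier R)"
      by simp
    also have "\<dots> \<le> ideal_length R (Y (K * Suc n + c)) (carrier R)" by (rule step)
    also have "\<dots> \<le> ideal_length R (Y (K * Suc (Suc n))) (carrier R)"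
      by (intro ideal_length_mono anti) (auto simp: K_def)
    finally show ?case .
  qed
  moreover have "K > 0" using K1(1) by (simp add: K_def)
  ultimately show ?case unfolding Y_def by blast
qed

text \<open>An integer, so that differences can be taken; it is meaningful only for finite length,
  whence the finiteness premises below.\<close>

definition colength :: "'a set \<Rightarrow> int" where
  "colength I = int (the_enat (ideal_length R I (carrier R)))"

lemma colength_add:
  assumes "ideal B R" "ideal C R" "C \<subseteq> B" "ideal_length R C (carrier R) \<noteq> \<infinity>"
  shows "colength C = int (the_enat (ideal_length R C B)) + colength B"
    and "ideal_length R C B \<noteq> \<infinity>" "ideal_length R B (carrier R) \<noteq> \<infinity>"
proof -
  have "ideal_length R C (carrier R) = ideal_length R C B + ideal_length R B (carrier R)"
    using assms by (intro ideal_length_add oneideal ideal_carrier)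
  moreover from this assms(4) obtain a b where
    "ideal_length R C B = enat a" "ideal_length R B (carrier R) = enat b"
    by (metis enat.exhaust plus_enat_simps(2,3))
  ultimately show "colength C = int (the_enat (ideal_length R C B)) + colength B"
    and "ideal_length R C B \<noteq> \<infinity>" "ideal_length R B (carrier R) \<noteq> \<infinity>"
    by (simp_all add: colength_def)
qed

lemma colength_le:
  assumes "ideal B R" "ideal C R" "C \<subseteq> B" "ideal_length R C (carrier R) \<noteq> \<infinity>"
    and "ideal_length R C B \<le> enat k"
  shows "colength C \<le> colength B + int k"
  using colength_add(1,2)[OF assms(1-4)] assms(5) by auto

lemma colength_mono:
  assumes "ideal B R" "ideal C R" "C \<subseteq> B" "ideal_length R C (carrier R) \<noteq> \<infinity>"
  shows "colength B \<le> colength C"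
  using colength_add(1)[OF assms] by simp

text \<open>Uniqueness of the binomial coefficients makes the definite description in
  \<open>hilbert_coeff\<close> denote the coefficient of any given expansion.\<close>

lemma hilbert_coeff_eq:
  assumes "krull_dim R = enat d" "ideal I R" "\<And>n. ideal_length R (ideal_power R I n) (carrier R) \<noteq> \<infinity>"
    and "\<forall>\<^sub>F n in sequentially. colength (ideal_power R I n) = hilbert_form d e n" "i \<le> d"
  shows "hilbert_coeff R I i = e i"
proof -
  have "(\<exists>l. module_length R (quotient_module R (ideal_power R I n)) = enat l \<and> int l = z)
      \<longleftrightarrow> colength (ideal_power R I n) = z" for n z
    using assms(3)[of n] module_length_quotient[OF ideal_power_ideal[OF assms(2), of n]]
    by (auto simp: colength_def)
  then have iff: "hilbert_coeffs R I e' \<longleftrightarrow>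
      (\<forall>\<^sub>F n in sequentially. colength (ideal_power R I n) = hilbert_form d e' n)" for e'
    by (simp add: hilbert_coeffs_def assms(1) hilbert_form_def)
  have "e' i = e i" if "hilbert_coeffs R I e'" for e'
  proof (rule hilbert_form_unique[OF _ assms(5)])
    from that assms(4) show "\<forall>\<^sub>F n in sequentially. hilbert_form d e' n = hilbert_form d e n"
      unfolding iff by (rule eventually_elim2) simp
  qed
  then show ?thesis
    unfolding hilbert_coeff_def using iff assms(4) by (intro the_equality) blast+
qed

end

text \<open>If no chain had length at least \<open>d\<close>, the supremum would be at most
  \<open>d - 1\<close>, which is smaller than \<open>d\<close> because \<open>d > 0\<close>.\<close>

lemma krull_dim_chain:
  assumes "krull_dim R = enat d" "d > 0"
  obtains Q :: "nat \<Rightarrow> 'a set" where "\<And>i. i \<le> d \<Longrightarrow> primeideal (Q i) R" "\<And>i. i < d \<Longrightarrow> Q i \<subset> Q (Suc i)"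
proof (cases "\<exists>n\<ge>d. \<exists>Q :: nat \<Rightarrow> 'a set. (\<forall>i\<le>n. primeideal (Q i) R) \<and> (\<forall>i<n. Q i \<subset> Q (Suc i))")
  case True
  then obtain n and Q :: "nat \<Rightarrow> 'a set" where "n \<ge> d" "\<forall>i\<le>n. primeideal (Q i) R" "\<forall>i<n. Q i \<subset> Q (Suc i)"
    by blast
  then show ?thesis by (intro that[of Q]) auto
next
  case False
  have "krull_dim R \<le> enat (d - 1)"
    unfolding krull_dim_def
  proof (rule Sup_least)
    fix z assume "z \<in> {enat n | n. \<exists>Q :: nat \<Rightarrow> 'a set. (\<forall>i\<le>n. primeideal (Q i) R) \<and> (\<forall>i<n. Q i \<subset> Q (Suc i))}"
    then obtain n where n: "z = enat n"
      "\<exists>Q :: nat \<Rightarrow> 'a set. (\<forall>i\<le>n. primeideal (Q i) R) \<and> (\<forall>i<n. Q i \<subset> Q (Suc i))" by blast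
    with False have "n < d" by (meson not_le)
    then show "z \<le> enat (d - 1)" using n(1) by simp
  qed
  with assms show ?thesis by simp
qed

section \<open>Powers of the maximal ideal of a local ring\<close>

locale noetherian_local_ring = local_ring \<mm> R + noetherian_ring R for \<mm> and R (structure)
begin

abbreviation (input) P :: "nat \<Rightarrow> 'a set" where "P n \<equiv> ideal_power R \<mm> n"

lemma noetherian: "noetherian_ring R"
  by (rule noetherian_ring_axioms)

lemma m_ideal: "ideal \<mm> R"
  by (rule is_ideal)

lemmas P_ideal = ideal_power_ideal[OF m_ideal]

lemma P_1: "P (Suc 0) = \<mm>"
  by (rule ideal_power_1[OF m_ideal])

lemma proper_ideal_subset:
  assumes "ideal I R" "I \<noteq> carrier R"
  shows "I \<subseteq> \<mm>"
  using exists_maximalideal[OF assms] maximalideal_unique by blast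

lemma ideal_length_residue_field: "ideal_length R \<mm> (carrier R) \<le> enat 1"
proof (rule ideal_length_leI)
  fix n N assume N: "ideal_chain R \<mm> (carrier R) n N"
  have *: "N i = \<mm> \<or> N i = carrier R" if "i \<le> n" for i
    using ideal_chainD[OF N that] I_maximal by blast
  show "enat n \<le> enat 1"
  proof (rule ccontr)
    assume "\<not> enat n \<le> enat 1"
    then have "n \<ge> 2" by simp
    then have "N 0 \<subset> N 1" "N 1 \<subset> N 2" "N 2 \<subseteq> carrier R" "\<mm> \<subseteq> N 0"
      using N by (auto simp: ideal_chain_def numeral_2_eq_2)
    then show False using *[of 1] \<open>n \<ge> 2\<close> by auto
  qed
qed

lemma P_finite: "ideal_length R (P n) (carrier R) \<noteq> \<infinity>"
proof (rule ideal_length_power_finite[OF noetherian m_ideal])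
  show "ideal_length R \<mm> (carrier R) \<noteq> \<infinity>" using ideal_length_residue_field by (auto dest: enat_ile)
qed

lemma finite_colength:
  assumes "ideal C R" "P n \<subseteq> C"
  shows "ideal_length R C (carrier R) \<noteq> \<infinity>"
  using colength_add(3)[OF assms(1) P_ideal assms(2) P_finite] .

text \<open>Each generator contributes at most the length of the residue field.\<close>

lemma ideal_length_prod_m_le:
  assumes "set as \<subseteq> carrier R" "ideal Z R"
  shows "ideal_length R ((Idl (set as)) \<cdot> \<mm> <+> Z) (Idl (set as) <+> Z) \<le> enat (length as)"
proof -
  have "ideal_length R ((Idl (set as)) \<cdot> \<mm> <+> Z) ((Idl (set as)) \<cdot> carrier R <+> Z)
      \<le> of_nat (length as) * ideal_length R \<mm> (carrier R)"
    by (intro ideal_length_prod_le assms oneideal m_ideal ideal_carrier)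
  also have "\<dots> \<le> of_nat (length as) * enat 1"
    by (intro mult_left_mono ideal_length_residue_field) simp
  finally show ?thesis
    by (simp add: ideal_prod_one genideal_ideal assms(1) of_nat_eq_enat one_enat_def[symmetric])
qed

lemma embedding_dimension_le: "ideal_length R (\<mm> \<cdot> \<mm>) \<mm> \<le> enat (min_num_generators R \<mm>)"
proof -
  obtain S where S: "S \<subseteq> carrier R" "finite S" "\<mm> = Idl S" using finetely_gen[OF m_ideal] by blast
  let ?G = "\<lambda>n. \<exists>S. S \<subseteq> carrier R \<and> finite S \<and> card S = n \<and> \<mm> = Idl S"
  have "?G (card S)" using S by blast
  then have "?G (min_num_generators R \<mm>)" unfolding min_num_generators_def by (rule LeastI)
  then obtain T where T: "T \<subseteq> carrier R" "finite T" "card T = min_num_generators R \<mm>" "\<mm> = Idl T" by blast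
  obtain as where as: "set as = T" "distinct as" using finite_distinct_list[OF T(2)] by blast
  have len: "length as = min_num_generators R \<mm>" using distinct_card[OF as(2)] as(1) T(3) by simp
  have "ideal_length R ((Idl (set as)) \<cdot> \<mm> <+> {\<zero>}) (Idl (set as) <+> {\<zero>}) \<le> enat (length as)"
    using as(1) T(1) by (intro ideal_length_prod_m_le zeroideal) simp
  then show ?thesis
    unfolding as(1) T(4)[symmetric] len
    by (simp add: set_add_absorb zeroideal ideal_zero m_ideal ideal_prod_is_ideal)
qed

text \<open>A chain of \<open>d\<close> prime inclusions bounds the colength of suitable powers
  below by \<open>n choose d\<close>, so \<open>K ^ d * c\<close> is at least one.\<close>

lemma leading_colength_pos:
  assumes "krull_dim R = enat d" "d > 0" "leading d (\<lambda>n. colength (P n)) c"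
  shows "c > 0"
proof -
  obtain Q :: "nat \<Rightarrow> 'a set" where Q: "\<And>i. i \<le> d \<Longrightarrow> primeideal (Q i) R" "\<And>i. i < d \<Longrightarrow> Q i \<subset> Q (Suc i)"
    using krull_dim_chain[OF assms(1,2)] by blast
  have Qm: "Q i \<subseteq> \<mm>" if "i \<le> d" for i
    using proper_ideal_subset[of "Q i"] Q(1)[OF that] primeideal.axioms(1) primeideal.I_notcarr by metis
  obtain K where K: "K > 0"
    "\<And>n. enat (n choose d) \<le> ideal_length R (Q 0 <+> P (K * Suc n)) (carrier R)"
    using ideal_length_prime_chain[of \<mm> d Q] noetherian m_ideal I_notcarr Q Qm by metis
  have Q0: "ideal (Q 0) R" using Q(1)[of 0] primeideal.axioms(1) by auto
  have le: "int (n choose d) \<le> colength (P (K * Suc n))" for n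
  proof -
    have "ideal_length R (Q 0 <+> P (K * Suc n)) (carrier R) \<le> ideal_length R (P (K * Suc n)) (carrier R)"
      by (intro ideal_length_mono set_add_upper2 Q0 P_ideal order_refl)
    with K(2)[of n] have "enat (n choose d) \<le> ideal_length R (P (K * Suc n)) (carrier R)"
      by (rule order_trans)
    then show ?thesis using P_finite[of "K * Suc n"] by (auto simp: colength_def)
  qed
  have "leading d (\<lambda>n. colength (P (K * n))) (int K ^ d * c)"
    using leading_dilate[OF assms(3) K(1)] .
  then have "leading d (\<lambda>n. colength (P (K * Suc n))) (int K ^ d * c)"
    using leading_shift[of d "\<lambda>n. colength (P (K * n))" 1] by simp
  from leading_mono[OF leading_binomial this] le have "1 \<le> int K ^ d * c" by simp
  then show ?thesis using K(1) by (smt (verit) mult_nonneg_nonpos of_nat_0_le_iff zero_le_power)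
qed

text \<open>The ideal \<open>I\<close> generated by \<open>ys\<close> generates the graded pieces of
  the powers of \<open>\<mm>\<close> from degree \<open>r\<close> on. Their lengths then grow with
  degree below \<open>length ys\<close>, and the colength with degree at most
  \<open>length ys\<close>.\<close>

lemma leading_colength_nonpos:
  assumes ys: "set ys \<subseteq> carrier R" "Idl (set ys) \<subseteq> \<mm>"
    and red: "P (Suc r) \<subseteq> (Idl (set ys)) \<cdot> P r <+> P (Suc (Suc r))"
    and lead: "leading (Suc (length ys)) (\<lambda>n. colength (P n)) c"
  shows "c \<le> 0"
proof -
  define I where "I = Idl (set ys)"
  have I: "ideal I R" unfolding I_def by (intro genideal_ideal ys)
  note IP = ideal_power_ideal[OF I]
  have P_m: "P n \<cdot> \<mm> = P (Suc n)" "\<mm> \<cdot> P n = P (Suc n)" for n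
    by (simp_all add: ideal_power_Suc ideal_prod_commute m_ideal P_ideal)
  have red': "P (Suc (k + r)) \<subseteq> I \<cdot> P (k + r) <+> P (Suc (Suc (k + r)))" for k
  proof -
    have "P (Suc (k + r)) = P (Suc r) \<cdot> P k"
      using ideal_power_add[OF m_ideal, of "Suc r" k] by (simp add: add.commute)
    also have "\<dots> \<subseteq> (I \<cdot> P r <+> P (Suc (Suc r))) \<cdot> P k"
      unfolding I_def by (intro ideal_prod_mono red order_refl)
    also have "\<dots> = I \<cdot> P r \<cdot> P k <+> P (Suc (Suc r)) \<cdot> P k"
      by (intro ideal_prod_distr P_ideal ideal_prod_is_ideal I)
    also have "I \<cdot> P r \<cdot> P k = I \<cdot> P (k + r)"
      using ideal_power_add[OF m_ideal, of r k] by (simp add: ideal_prod_assoc I P_ideal add.commute)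
    also have "P (Suc (Suc r)) \<cdot> P k = P (Suc (Suc (k + r)))"
      using ideal_power_add[OF m_ideal, of "Suc (Suc r)" k] by (simp add: add.commute)
    finally show ?thesis .
  qed
  \<comment> \<open>The reduction is iterated modulo the next power; the error stays there because
    \<open>I \<subseteq> \<mm>\<close>.\<close>
  have main: "P (k + r) \<subseteq> ideal_power R I k \<cdot> P r <+> P (Suc (k + r))" for k
  proof (induction k)
    case 0
    show ?case using set_add_upper1[OF P_ideal P_ideal, of r "Suc r"] by (simp add: ideal_carrier_prod P_ideal)
  next
    case (Suc k)
    let ?T = "ideal_power R I (Suc k) \<cdot> P r <+> P (Suc (Suc (k + r)))"
    have IkP: "ideal (ideal_power R I k \<cdot> P r) R" for k by (intro ideal_prod_is_ideal IP P_ideal)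
    have T: "ideal ?T R" by (intro add_ideals IkP P_ideal)
    note up1 = set_add_upper1[OF IkP P_ideal] and up2 = set_add_upper2[OF IkP P_ideal]
    have "I \<cdot> P (k + r) \<subseteq> I \<cdot> (ideal_power R I k \<cdot> P r <+> P (Suc (k + r)))"
      by (intro ideal_prod_mono Suc.IH order_refl)
    also have "\<dots> = I \<cdot> (ideal_power R I k \<cdot> P r) <+> I \<cdot> P (Suc (k + r))"
      by (intro ideal_prod_distr I IkP P_ideal)
    also have "I \<cdot> (ideal_power R I k \<cdot> P r) = ideal_power R I (Suc k) \<cdot> P r"
      by (simp add: ideal_power_Suc ideal_prod_commute[OF IP I] ideal_prod_assoc I IP P_ideal)
    also have "\<dots> <+> I \<cdot> P (Suc (k + r)) \<subseteq> ?T"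
    proof (rule set_add_least[OF T up1])
      have "I \<cdot> P (Suc (k + r)) \<subseteq> \<mm> \<cdot> P (Suc (k + r))"
        unfolding I_def by (intro ideal_prod_mono ys order_refl)
      also have "\<dots> \<subseteq> ?T" unfolding P_m by (rule up2)
      finally show "I \<cdot> P (Suc (k + r)) \<subseteq> ?T" .
    qed
    finally have "I \<cdot> P (k + r) <+> P (Suc (Suc (k + r))) \<subseteq> ?T" by (intro set_add_least[OF T] up2)
    then show ?case using red'[of k] by simp
  qed
  define L where "L = the_enat (ideal_length R (P (Suc r)) (P r))"
  have L: "ideal_length R (P (Suc r)) (P r) = enat L"
    using colength_add(2)[OF P_ideal P_ideal _ P_finite, of "Suc r" r] ideal_power_antimono[OF m_ideal, of r "Suc r"]
    by (auto simp: L_def)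
  have bound: "colength (P (Suc (k + r))) - colength (P (k + r)) \<le> int L * int ((k + length ys - 1) choose k)" for k
  proof -
    obtain as where as: "set as \<subseteq> carrier R" "ideal_power R I k = Idl (set as)"
      "length as = (k + length ys - 1) choose k"
      using ideal_power_generators[OF ys(1), of k] unfolding I_def by blast
    have IkP: "ideal (ideal_power R I k \<cdot> P n) R" for n by (intro ideal_prod_is_ideal IP P_ideal)
    have Ik: "ideal_power R I k \<subseteq> P k"
      using ys(2) by (intro ideal_power_mono) (simp add: I_def)
    have sub: "ideal_power R I k \<cdot> P n \<subseteq> P (k + n)" for n
      unfolding ideal_power_add[OF m_ideal] by (intro ideal_prod_mono Ik order_refl)
    have "ideal_length R (ideal_power R I k \<cdot> P (Suc r) <+> P (Suc (k + r)))
        (ideal_power R I k \<cdot> P r <+> P (Suc (k + r))) \<le> of_nat (length as) * ideal_length R (P (Suc r)) (P r)"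
      unfolding as(2) by (intro ideal_length_prod_le as P_ideal ideal_power_antimono m_ideal) simp
    moreover have "ideal_power R I k \<cdot> P (Suc r) <+> P (Suc (k + r)) = P (Suc (k + r))"
      using sub[of "Suc r"] set_add_least[OF P_ideal sub[of "Suc r"]] set_add_upper2[OF IkP P_ideal]
      by (simp add: subset_antisym)
    moreover have "ideal_power R I k \<cdot> P r <+> P (Suc (k + r)) = P (k + r)"
      using main[of k] sub[of r] ideal_power_antimono[OF m_ideal, of "k + r" "Suc (k + r)"]
      by (intro subset_antisym set_add_least P_ideal) auto
    ultimately have "ideal_length R (P (Suc (k + r))) (P (k + r)) \<le> enat (length as * L)"
      by (simp add: L of_nat_eq_enat)
    moreover have "P (Suc (k + r)) \<subseteq> P (k + r)" by (intro ideal_power_antimono m_ideal) simp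
    ultimately have "colength (P (Suc (k + r))) \<le> colength (P (k + r)) + int (length as * L)"
      by (intro colength_le P_ideal P_finite)
    then show ?thesis by (simp add: as(3) algebra_simps)
  qed
  \<comment> \<open>The number of monomials has degree \<open>length ys - 1\<close>; with no
    generators it is zero for \<open>k \<ge> 1\<close>.\<close>
  have "leading (length ys) (\<lambda>k. int L * int ((k + length ys - 1) choose k)) 0"
  proof (cases "length ys")
    case 0
    then show ?thesis by (auto simp: eventually_sequentially binomial_eq_0 intro!: exI[of _ 1])
  next
    case (Suc e)
    have "leading e (\<lambda>k. int L * int ((k + e) choose e)) (int L * 1)"
      by (intro leading_cmult leading_binomial_shift)
    moreover have "(k + length ys - 1) choose k = (k + e) choose e" for k
      using binomial_symmetric[of k "k + e"] by (simp add: Suc)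
    ultimately show ?thesis unfolding Suc using leading_Suc_0 by (simp add: Suc del: leading.simps)
  qed
  moreover have "leading (length ys) (\<lambda>k. colength (P (Suc (k + r))) - colength (P (k + r))) c"
    using lead leading_shift[of "Suc (length ys)" "\<lambda>n. colength (P n)" r c] by simp
  ultimately show ?thesis using bound by (intro leading_mono[of "length ys" _ c _ 0]) auto
qed

end

section \<open>Minimal reductions of the maximal ideal\<close>

locale maximal_ideal_reduction = noetherian_local_ring +
  fixes J :: "'a set" and x :: "nat \<Rightarrow> 'a" and d r :: nat
  assumes dim: "krull_dim R = enat d" and d_pos: "d > 0"
    and x_carrier: "x ` {..<d} \<subseteq> carrier R" and J_def: "J = Idl (x ` {..<d})" and J_subset: "J \<subseteq> \<mm>"
    and reduction: "P (Suc r) = J \<cdot> P r"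
begin

abbreviation (input) Jp :: "nat \<Rightarrow> 'a set" where "Jp n \<equiv> ideal_power R J n"

lemma J_list: "J = Idl (set (map x [0..<d]))" "set (map x [0..<d]) \<subseteq> carrier R"
  using x_carrier by (auto simp: J_def atLeast0LessThan)

lemma J_ideal: "ideal J R"
  unfolding J_def by (intro genideal_ideal x_carrier)

lemmas Jp_ideal = ideal_power_ideal[OF J_ideal]

lemma power_reduction: "P (n + r) = Jp n \<cdot> P r"
proof (induction n)
  case 0
  then show ?case by (simp add: ideal_carrier_prod P_ideal)
next
  case (Suc n)
  have "P (Suc n + r) = Jp n \<cdot> P r \<cdot> \<mm>" using Suc by (simp add: ideal_power_Suc)
  also have "\<dots> = Jp n \<cdot> P (Suc r)"
    by (simp add: ideal_power_Suc ideal_prod_assoc Jp_ideal P_ideal m_ideal)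
  also have "\<dots> = Jp (Suc n) \<cdot> P r"
    unfolding reduction by (simp add: ideal_power_Suc ideal_prod_assoc Jp_ideal P_ideal J_ideal)
  finally show ?case .
qed

lemma Jp_subset: "Jp n \<subseteq> P n"
  by (rule ideal_power_mono[OF J_subset])

lemma P_subset_Jp: "P (n + r) \<subseteq> Jp n"
  using power_reduction ideal_prod_inter[OF Jp_ideal P_ideal] by blast

lemma Jp_finite: "ideal_length R (Jp n) (carrier R) \<noteq> \<infinity>"
  by (rule finite_colength[OF Jp_ideal P_subset_Jp])

text \<open>From degree \<open>r\<close> on the powers of \<open>\<mm>\<close> are
  \<open>Jp n \<cdot> P r\<close>, so the \<open>d\<close> generators of \<open>J\<close> serve as
  variables and the degree is bounded by \<open>d\<close>.\<close>

lemma leading_P: "leading (Suc d) (\<lambda>n. colength (P n)) 0"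
proof -
  have fin: "ideal_length R (P (Suc n)) (P n) \<noteq> \<infinity>" for n
    using colength_add(2)[OF P_ideal P_ideal ideal_power_antimono[OF m_ideal] P_finite] by simp
  have "leading (length (map x [0..<d])) (\<lambda>n. int (the_enat (ideal_length R (Jp (Suc n) \<cdot> P r) (Jp n \<cdot> P r)))) 0"
    by (rule leading_powers[OF noetherian J_list(2) P_ideal, folded J_list(1)])
      (use fin in \<open>simp flip: power_reduction\<close>)
  then have "leading d (\<lambda>n. int (the_enat (ideal_length R (P (Suc (n + r))) (P (n + r))))) 0"
    by (simp flip: power_reduction)
  moreover have "int (the_enat (ideal_length R (P (Suc n)) (P n))) = colength (P (Suc n)) - colength (P n)" for n
    using colength_add(1)[OF P_ideal P_ideal ideal_power_antimono[OF m_ideal] P_finite, of n "Suc n"] by simp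
  ultimately have "leading d (\<lambda>n. colength (P (Suc (n + r))) - colength (P (n + r))) 0" by simp
  then show ?thesis using leading_shift[of "Suc d" "\<lambda>n. colength (P n)" r 0] by simp
qed

lemma leading_Jp: "leading (Suc d) (\<lambda>n. colength (Jp n)) 0"
proof -
  have fin: "ideal_length R (Jp (Suc n)) (Jp n) \<noteq> \<infinity>" for n
    using colength_add(2)[OF Jp_ideal Jp_ideal ideal_power_antimono[OF J_ideal] Jp_finite] by simp
  have "leading (length (map x [0..<d])) (\<lambda>n. int (the_enat (ideal_length R (Jp (Suc n) \<cdot> carrier R) (Jp n \<cdot> carrier R)))) 0"
    by (rule leading_powers[OF noetherian J_list(2) oneideal, folded J_list(1)])
      (use fin in \<open>simp add: ideal_prod_one Jp_ideal\<close>)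
  then have "leading d (\<lambda>n. int (the_enat (ideal_length R (Jp (Suc n)) (Jp n)))) 0"
    by (simp add: ideal_prod_one Jp_ideal)
  moreover have "int (the_enat (ideal_length R (Jp (Suc n)) (Jp n))) = colength (Jp (Suc n)) - colength (Jp n)" for n
    using colength_add(1)[OF Jp_ideal Jp_ideal ideal_power_antimono[OF J_ideal] Jp_finite, of n "Suc n"] by simp
  ultimately show ?thesis by simp
qed

text \<open>The powers of \<open>J\<close> are squeezed by
  \<open>P (n + r) \<subseteq> Jp n \<subseteq> P n\<close>, and a fixed shift does not change the
  leading coefficient.\<close>

lemma leading_coefficients_eq:
  assumes "leading d (\<lambda>n. colength (P n)) c" "leading d (\<lambda>n. colength (Jp n)) c'"
  shows "c' = c"
proof (rule antisym)
  have "colength (P n) \<le> colength (Jp n)" for n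
    by (intro colength_mono P_ideal Jp_ideal Jp_subset Jp_finite)
  then show "c \<le> c'" using leading_mono[OF assms] by simp
  have "colength (Jp n) \<le> colength (P (n + r))" for n
    by (intro colength_mono P_ideal Jp_ideal P_subset_Jp P_finite)
  moreover have "leading d (\<lambda>n. colength (P (n + r))) c"
    using assms(1) leading_shift[of d "\<lambda>n. colength (P n)" r c] by simp
  ultimately show "c' \<le> c" using leading_mono[OF assms(2)] by simp
qed

text \<open>If the \<open>d\<close> generators of \<open>J\<close> were dependent modulo \<open>\<mm>\<^sup>2\<close>, then \<open>d - 1\<close> of them would force
  \<open>colength (P n)\<close> to grow with degree less than \<open>d\<close>.\<close>

lemma reduction_independent: "enat d \<le> ideal_length R (\<mm> \<cdot> \<mm>) (J <+> \<mm> \<cdot> \<mm>)"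
proof -
  have mm: "ideal (\<mm> \<cdot> \<mm>) R" by (intro ideal_prod_is_ideal m_ideal)
  \<comment> \<open>The generators of \<open>J\<close> are adjoined to
    \<open>\<mm> \<cdot> \<mm>\<close> one at a time; independence means that each step is
    strict.\<close>
  define N where "N i = Idl (x ` {..<i}) <+> \<mm> \<cdot> \<mm>" for i
  have xc: "x ` {..<i} \<subseteq> carrier R" if "i \<le> d" for i using x_carrier that by auto
  have G: "ideal (Idl (x ` {..<i})) R" if "i \<le> d" for i by (intro genideal_ideal xc that)
  have N: "ideal (N i) R" if "i \<le> d" for i unfolding N_def by (intro add_ideals G that mm)
  have N_mono: "N i \<subseteq> N j" if "i \<le> j" "j \<le> d" for i j
    unfolding N_def using that by (intro set_add_mono subset_Idl_subset xc) auto
  have "N i \<noteq> N (Suc i)" if i: "i < d" for i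
  proof
    assume eq: "N i = N (Suc i)"
    \<comment> \<open>Removal is by index, so \<open>ys\<close> has length \<open>d - 1\<close> even
      if generators repeat.\<close>
    define ys where "ys = map x (filter (\<lambda>j. j \<noteq> i) [0..<d])"
    have set_ys: "set ys = x ` ({..<d} - {i})" by (auto simp: ys_def)
    have "filter (\<lambda>j. j \<noteq> i) [0..<d] = [0..<i] @ [Suc i..<d]"
    proof -
      have "[0..<d] = [0..<i] @ i # [Suc i..<d]" 
        using i upt_add_eq_append[of 0 i "d - i"] by (simp add: upt_conv_Cons)
      then show ?thesis by (simp add: filter_id_conv)
    qed
    then have len: "Suc (length ys) = d" using i by (simp add: ys_def)
    define I where "I = Idl (set ys)"
    have ysc: "set ys \<subseteq> carrier R" using x_carrier by (auto simp: set_ys)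
    have I: "ideal I R" unfolding I_def by (intro genideal_ideal ysc)
    have "x i \<in> N (Suc i)"
      using genideal_self[OF xc[of "Suc i"]] i set_add_upper1[OF G[of "Suc i"] mm] by (auto simp: N_def)
    moreover have "N i \<subseteq> I <+> \<mm> \<cdot> \<mm>"
      unfolding N_def I_def using i by (intro set_add_mono subset_Idl_subset ysc) (auto simp: set_ys)
    ultimately have xi: "x i \<in> I <+> \<mm> \<cdot> \<mm>" using eq by blast
    have "x j \<in> I <+> \<mm> \<cdot> \<mm>" if "j < d" for j
    proof (cases "j = i")
      case False
      then have "x j \<in> I" unfolding I_def using genideal_self[OF ysc] that by (auto simp: set_ys)
      then show ?thesis using set_add_upper1[OF I mm] by blast
    qed (use xi in simp)
    then have JI: "J \<subseteq> I <+> \<mm> \<cdot> \<mm>" unfolding J_def by (intro genideal_minimal add_ideals I mm) auto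
    have "P (Suc r) \<subseteq> (I <+> \<mm> \<cdot> \<mm>) \<cdot> P r" unfolding reduction by (intro ideal_prod_mono JI order_refl)
    also have "\<dots> = I \<cdot> P r <+> \<mm> \<cdot> \<mm> \<cdot> P r" by (intro ideal_prod_distr P_ideal I mm)
    also have "\<mm> \<cdot> \<mm> \<cdot> P r = P (Suc (Suc r))"
      unfolding ideal_prod_commute[OF mm P_ideal] by (simp add: ideal_power_Suc ideal_prod_assoc P_ideal m_ideal)
    finally have red: "P (Suc r) \<subseteq> I \<cdot> P r <+> P (Suc (Suc r))" .
    have "I \<subseteq> J" unfolding I_def J_def using x_carrier by (intro subset_Idl_subset) (auto simp: set_ys)
    then have Im: "I \<subseteq> \<mm>" using J_subset by blast
    obtain c where c: "leading d (\<lambda>n. colength (P n)) c" using leading_P unfolding leading_Suc_0_iff by blast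
    have "c \<le> 0"
      using leading_colength_nonpos[OF ysc Im[unfolded I_def] red[unfolded I_def]] c unfolding len by blast
    moreover have "c > 0" using leading_colength_pos[OF dim d_pos c] .
    ultimately show False by simp
  qed
  then have "N i \<subset> N (Suc i)" if "i < d" for i
    using N_mono[of i "Suc i"] that by auto
  moreover have "\<mm> \<cdot> \<mm> \<subseteq> N i" "N i \<subseteq> J <+> \<mm> \<cdot> \<mm>" if "i \<le> d" for i
    using set_add_upper2[OF G mm] N_mono[of i d] that by (simp_all add: N_def J_def)
  ultimately have "ideal_chain R (\<mm> \<cdot> \<mm>) (J <+> \<mm> \<cdot> \<mm>) d N"
    unfolding ideal_chain_def using N by blast
  then show ?thesis by (rule ideal_length_ge)
qed

text \<open>Of the at most \<open>min_num_generators R \<mm>\<close> dimensions of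
  \<open>\<mm>\<close> modulo its square, \<open>J\<close> takes up at least
  \<open>d\<close>.\<close>

lemma reduction_colength: "\<exists>h. ideal_length R (J <+> \<mm> \<cdot> \<mm>) \<mm> = enat h \<and> h + d \<le> min_num_generators R \<mm>"
proof -
  have mm: "ideal (\<mm> \<cdot> \<mm>) R" by (intro ideal_prod_is_ideal m_ideal)
  have sub: "J <+> \<mm> \<cdot> \<mm> \<subseteq> \<mm>"
    using ideal_prod_inter[OF m_ideal m_ideal] J_subset by (intro set_add_least m_ideal) auto
  have "ideal_length R (\<mm> \<cdot> \<mm>) \<mm> = ideal_length R (\<mm> \<cdot> \<mm>) (J <+> \<mm> \<cdot> \<mm>) + ideal_length R (J <+> \<mm> \<cdot> \<mm>) \<mm>"
    by (intro ideal_length_add m_ideal add_ideals J_ideal mm set_add_upper2 sub)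
  then have "enat d + ideal_length R (J <+> \<mm> \<cdot> \<mm>) \<mm> \<le> ideal_length R (\<mm> \<cdot> \<mm>) \<mm>"
    using add_right_mono[OF reduction_independent] by metis
  also note embedding_dimension_le
  finally have "enat d + ideal_length R (J <+> \<mm> \<cdot> \<mm>) \<mm> \<le> enat (min_num_generators R \<mm>)" .
  then show ?thesis by (cases "ideal_length R (J <+> \<mm> \<cdot> \<mm>) \<mm>") (auto simp: add.commute)
qed

text \<open>The filtration \<open>J\<^sup>n\<^sup>+\<^sup>2 \<subseteq> J\<^sup>n \<mm>\<^sup>2 \<subseteq> J\<^sup>n (J + \<mm>\<^sup>2) \<subseteq> J\<^sup>n \<mm> \<subseteq> J\<^sup>n\<close>, together with
  \<open>J\<^sup>n \<mm>\<^sup>2 \<subseteq> \<mm>\<^sup>n\<^sup>+\<^sup>2\<close>.\<close>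

lemma colength_comparison:
  assumes D: "d = Suc D"
  shows "colength (P (n + 2)) \<le> colength (Jp n)
    + (1 + (int (min_num_generators R \<mm>) - int d)) * int ((n + D) choose D) + int ((n + 1 + D) choose D)"
proof -
  have mm: "ideal (\<mm> \<cdot> \<mm>) R" by (intro ideal_prod_is_ideal m_ideal)
  have P2: "P 2 = \<mm> \<cdot> \<mm>" using P_1 by (simp add: numeral_2_eq_2 ideal_power_Suc ideal_carrier_prod m_ideal)
  obtain h where h: "ideal_length R (J <+> \<mm> \<cdot> \<mm>) \<mm> = enat h" "h + d \<le> min_num_generators R \<mm>"
    using reduction_colength by blast
  define Z where "Z = Jp n \<cdot> (\<mm> \<cdot> \<mm>)"
  have Z: "ideal Z R" unfolding Z_def by (intro ideal_prod_is_ideal Jp_ideal mm)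
  have Jm: "ideal (Jp n \<cdot> \<mm>) R" by (intro ideal_prod_is_ideal Jp_ideal m_ideal)
  have JJm: "ideal (J <+> \<mm> \<cdot> \<mm>) R" by (intro add_ideals J_ideal mm)
  have W: "ideal (Jp n \<cdot> (J <+> \<mm> \<cdot> \<mm>)) R" by (intro ideal_prod_is_ideal Jp_ideal JJm)
  have W_eq: "Jp n \<cdot> (J <+> \<mm> \<cdot> \<mm>) = Jp (Suc n) <+> Z"
    unfolding Z_def by (simp add: ideal_prod_distr(1) Jp_ideal J_ideal mm ideal_power_Suc)
  have JJm_m: "J <+> \<mm> \<cdot> \<mm> \<subseteq> \<mm>"
    using ideal_prod_inter[OF m_ideal m_ideal] J_subset by (intro set_add_least m_ideal) auto
  \<comment> \<open>A power of \<open>\<mm>\<close> inside \<open>Z\<close> makes all lengths in the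
    filtration finite.\<close>
  have "P (n + (r + 2)) = P (n + r) \<cdot> P 2" using ideal_power_add[OF m_ideal, of "n + r" 2] by (simp add: add.assoc)
  also have "\<dots> = Jp n \<cdot> (P r \<cdot> P 2)" unfolding power_reduction by (intro ideal_prod_assoc Jp_ideal P_ideal)
  also have "\<dots> \<subseteq> Z"
    unfolding Z_def P2 using ideal_prod_inter[OF P_ideal mm] by (intro ideal_prod_mono[OF order_refl]) auto
  finally have PZ: "P (n + (r + 2)) \<subseteq> Z" .
  have Z_fin: "ideal_length R Z (carrier R) \<noteq> \<infinity>" by (rule finite_colength[OF Z PZ])
  obtain as where as: "set as \<subseteq> carrier R" "Jp n = Idl (set as)" "length as = (n + D) choose n"
    using ideal_power_generators[OF J_list(2), of n, folded J_list(1)] D by auto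
  obtain bs where bs: "set bs \<subseteq> carrier R" "Jp (Suc n) = Idl (set bs)" "length bs = (Suc n + D) choose Suc n"
    using ideal_power_generators[OF J_list(2), of "Suc n", folded J_list(1)] D by auto
  have abs0: "A <+> {\<zero>} = A" if "ideal A R" for A
    using that by (intro set_add_absorb zeroideal) (auto simp: ideal_zero)
  have l1: "ideal_length R (Jp n \<cdot> \<mm>) (Jp n) \<le> enat (length as)"
    using ideal_length_prod_m_le[OF as(1) zeroideal] unfolding as(2)[symmetric] by (simp add: abs0 Jm Jp_ideal)
  have "ideal_length R (Jp n \<cdot> (J <+> \<mm> \<cdot> \<mm>) <+> {\<zero>}) (Jp n \<cdot> \<mm> <+> {\<zero>})
      \<le> of_nat (length as) * ideal_length R (J <+> \<mm> \<cdot> \<mm>) \<mm>"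
    unfolding as(2) by (intro ideal_length_prod_le as m_ideal JJm zeroideal JJm_m)
  then have l2: "ideal_length R (Jp n \<cdot> (J <+> \<mm> \<cdot> \<mm>)) (Jp n \<cdot> \<mm>) \<le> enat (length as * h)"
    by (simp add: abs0 Jm W h(1) of_nat_eq_enat)
  \<comment> \<open>Since \<open>J \<cdot> \<mm> \<subseteq> \<mm> \<cdot> \<mm>\<close>, the bottom
    quotient is a vector space spanned by the monomials of degree \<open>n + 1\<close>.\<close>
  have "Jp (Suc n) \<cdot> \<mm> \<subseteq> Z"
    unfolding Z_def ideal_power_Suc ideal_prod_assoc[OF Jp_ideal J_ideal m_ideal]
    using J_subset by (intro ideal_prod_mono) auto
  then have "Jp (Suc n) \<cdot> \<mm> <+> Z = Z"
    using set_add_upper2[OF _ Z, of "Jp (Suc n) \<cdot> \<mm>"] Z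
    by (intro subset_antisym set_add_least ideal_prod_is_ideal Jp_ideal m_ideal) (auto intro: ideal_prod_is_ideal Jp_ideal m_ideal)
  then have l3: "ideal_length R Z (Jp n \<cdot> (J <+> \<mm> \<cdot> \<mm>)) \<le> enat (length bs)"
    using ideal_length_prod_m_le[OF bs(1) Z] unfolding bs(2)[symmetric] W_eq by simp
  have Z_W: "Z \<subseteq> Jp n \<cdot> (J <+> \<mm> \<cdot> \<mm>)" unfolding W_eq by (intro set_add_upper2 Jp_ideal Z)
  have W_fin: "ideal_length R (Jp n \<cdot> (J <+> \<mm> \<cdot> \<mm>)) (carrier R) \<noteq> \<infinity>"
    by (rule colength_add(3)[OF W Z Z_W Z_fin])
  have W_Jm: "Jp n \<cdot> (J <+> \<mm> \<cdot> \<mm>) \<subseteq> Jp n \<cdot> \<mm>" by (intro ideal_prod_mono JJm_m order_refl)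
  have Jm_fin: "ideal_length R (Jp n \<cdot> \<mm>) (carrier R) \<noteq> \<infinity>"
    by (rule colength_add(3)[OF Jm W W_Jm W_fin])
  have "Z \<subseteq> P (n + 2)"
    unfolding Z_def ideal_power_add[OF m_ideal] P2 by (intro ideal_prod_mono Jp_subset order_refl)
  then have "colength (P (n + 2)) \<le> colength Z" by (intro colength_mono P_ideal Z Z_fin)
  also have "\<dots> \<le> colength (Jp n \<cdot> (J <+> \<mm> \<cdot> \<mm>)) + int (length bs)"
    by (rule colength_le[OF W Z Z_W Z_fin l3])
  also have "colength (Jp n \<cdot> (J <+> \<mm> \<cdot> \<mm>)) \<le> colength (Jp n \<cdot> \<mm>) + int (length as * h)"
    by (rule colength_le[OF Jm W W_Jm W_fin l2])
  also have "colength (Jp n \<cdot> \<mm>) \<le> colength (Jp n) + int (length as)"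
    using ideal_prod_inter[OF Jp_ideal m_ideal] by (intro colength_le Jp_ideal Jm Jm_fin l1) auto
  finally have "colength (P (n + 2)) \<le> colength (Jp n) + (1 + int h) * int (length as) + int (length bs)"
    by (simp add: algebra_simps)
  also have "\<dots> \<le> colength (Jp n) + (1 + (int (min_num_generators R \<mm>) - int d)) * int (length as) + int (length bs)"
    using h(2) by (intro add_mono mult_right_mono) auto
  \<comment> \<open>Symmetry turns the monomial counts into binomials with fixed lower index
    \<open>D\<close>, which are polynomials in \<open>n\<close>.\<close>
  finally show ?thesis
    unfolding as(3) bs(3) using binomial_symmetric[of n "n + D"] binomial_symmetric[of "Suc n" "Suc n + D"] by simp
qed

theorem hilbert_coefficient_bound:
  "2 * hilbert_coeff R \<mm> 0 - hilbert_coeff R \<mm> 1 + hilbert_coeff R J 1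
    \<le> int (min_num_generators R \<mm>) - int d + 2"
proof -
  obtain D where D: "d = Suc D" using d_pos gr0_implies_Suc by blast
  obtain e where e: "\<forall>\<^sub>F n in sequentially. colength (P n) = hilbert_form d e n"
    using hilbert_form_exists[OF leading_P] by blast
  obtain e' where e': "\<forall>\<^sub>F n in sequentially. colength (Jp n) = hilbert_form d e' n"
    using hilbert_form_exists[OF leading_Jp] by blast
  have "leading d (\<lambda>n. colength (P n)) (e 0)"
    using e by (intro leading_cong[OF leading_hilbert_form]) (simp add: eq_commute)
  moreover have "leading d (\<lambda>n. colength (Jp n)) (e' 0)"
    using e' by (intro leading_cong[OF leading_hilbert_form]) (simp add: eq_commute)
  ultimately have "e' 0 = e 0" by (rule leading_coefficients_eq)
  from hilbert_coefficient_comparison[OF e[unfolded D] e'[unfolded D] this colength_comparison[OF D]]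
  have "2 * e 0 - e 1 + e' 1 \<le> 2 + (int (min_num_generators R \<mm>) - int d)" .
  moreover have "hilbert_coeff R \<mm> i = e i" "hilbert_coeff R J i = e' i" if "i \<le> d" for i
    using hilbert_coeff_eq[OF dim m_ideal P_finite e that] hilbert_coeff_eq[OF dim J_ideal Jp_finite e' that] .
  ultimately show ?thesis using d_pos by simp
qed

end

theorem theorem2p3:
  fixes R :: "('a, 'b) ring_scheme" (structure)
    and \<mm> J :: "'a set" and d :: nat
  assumes "local_ring \<mm> R"
    and "noetherian_ring R"
    and "krull_dim R = enat d"
    and "d > 0"
    and "infinite (carrier (R Quot \<mm>))"
    and "minimal_reduction R J \<mm>"
  shows "2 * hilbert_coeff R \<mm> 0 - hilbert_coeff R \<mm> 1 + hilbert_coeff R J 1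
    \<le> int (min_num_generators R \<mm>) - int d + 2"
proof -
  interpret local_ring \<mm> R by (rule assms(1))
  obtain x r where "J \<subseteq> \<mm>" "x ` {..<d} \<subseteq> carrier R" "J = Idl (x ` {..<d})"
    "ideal_power R \<mm> (Suc r) = J \<cdot> ideal_power R \<mm> r"
    using assms(6) unfolding minimal_reduction_def assms(3) by auto
  then interpret maximal_ideal_reduction \<mm> R J x d r
    using assms by (intro maximal_ideal_reduction.intro noetherian_local_ring.intro maximal_ideal_reduction_axioms.intro)
  show ?thesis by (rule hilbert_coefficient_bound)
qed

end
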